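(* Let $(X,T)$ be a linearly recurrent minimal Cantor system given by a nested sequence of CKR partitions $(\mathcal P(n))_{n\ge 0}$ satisfying (KR1)–(KR6) and (LR), with associated matrices $(M(n))_{n\ge1}$, and let $\mu$ be its unique $T$-invariant probability measure. Let $\alpha\in\mathbb R$ and $\lambda=\exp(2i\pi\alpha)$. (1) $\lambda$ is an eigenvalue of $(X,T)$ with respect to $\mu$ if and only if $\sum_{n\ge2}|\!|\!|\alpha P(n)H(1)|\!|\!|^2<\infty$. (2) $\lambda$ is a continuous eigenvalue of $(X,T)$ if and only if $\sum_{n\ge2}|\!|\!|\alpha P(n)H(1)|\!|\!|<\infty$.
   Context: A minimal Cantor system $(X,T)$: $X$ is a Cantor space, $T:X\to X$ a homeomorphism all of whose orbits are dense. A clopen Kakutani–Rohlin (CKR) partition is a partition $\{T^{-j}B_k:1\le k\le C,\ 0\le j<h_k\}$ of $X$ with $B_k$ clopen and $h_k\ge1$ integers. Consider a sequence of CKR partitions $\mathcal P(n)=\{T^{-j}B_k(n):1\le k\le C(n),0\le j<h_k(n)\}$, $n\ge0$, with $\mathcal P(0)$ trivial ($C(0)=1$, $B_1(0)=X$, $h_1(0)=1$); roof $B(n)=\bigcup_kB_k(n)$, $k$-th tower $\mathcal T_k(n)=\bigcup_{0\le j<h_k(n)}T^{-j}B_k(n)$. Conditions: (KR1) $B(n+1)\subseteq B(n)$; (KR2) every atom of $\mathcal P(n+1)$ is contained in an atom of $\mathcal P(n)$; (KR3) $\bigcap_nB(n)$ is a single point; (KR4) the partitions together generate the topology of $X$;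 (KR5) for all $n\ge1$, $1\le k\le C(n-1)$, $1\le l\le C(n)$ there is $0\le j<h_l(n)$ with $T^{-j}B_l(n)\subseteq B_k(n-1)$; (KR6) $B(n)\subseteq B_1(n-1)$ for all $n\ge1$. The matrix $M(n)$ ($n\ge1$) is the $C(n)\times C(n-1)$ matrix with entries $m_{l,k}(n)=\#\{0\le j<h_l(n):T^{-j}B_l(n)\subseteq B_k(n-1)\}$. $H(n)=(h_1(n),\dots,h_{C(n)}(n))^T$, so $H(n)=M(n)H(n-1)$ and $H(1)=M(1)$. For $n>m\ge0$, $P(n,m)=M(n)M(n-1)\cdots M(m+1)$, $P(n)=P(n,1)$. (LR): there is $L$ with $h_l(n)\le L\,h_k(n-1)$ for all $n\ge1$, $l\le C(n)$, $k\le C(n-1)$. A minimal Cantor system is linearly recurrent if it admits such a sequence satisfying (KR1)–(KR6) and (LR); such systems are uniquely ergodic. For $x\in\mathbb R$, $|\!|\!|x|\!|\!|$ is the distance from $x$ to the nearest integer; for $V=(v_1,\dots,v_m)^T$, $|\!|\!|V|\!|\!|=\max_j|\!|\!|v_j|\!|\!|$. $\lambda$ is an eigenvalue w.r.t. $\mu$ if $f\circ T=\lambda f$ for some nonzero $f\in L^2(\mu)$; a continuous eigenvalue if such $f$ can be taken continuous. *)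

theory Defs
  imports "HOL-Probability.Probability"
begin

definition cantor_space :: "'a::metric_space set \<Rightarrow> bool" where
  "cantor_space X \<longleftrightarrow> X \<noteq> {} \<and> compact X \<and> (\<forall>x\<in>X. x islimpt X)
     \<and> (\<forall>x\<in>X. connected_component_set X x = {x})"

definition orbit :: "('a \<Rightarrow> 'a) \<Rightarrow> ('a \<Rightarrow> 'a) \<Rightarrow> 'a \<Rightarrow> 'a set" where
  "orbit T Ti x = {(T ^^ n) x | n. True} \<union> {(Ti ^^ n) x | n. True}"

definition minimal_cantor_system :: "'a::metric_space set \<Rightarrow> ('a \<Rightarrow> 'a) \<Rightarrow> ('a \<Rightarrow> 'a) \<Rightarrow> bool" where
  "minimal_cantor_system X T Ti \<longleftrightarrow> cantor_space X \<and> homeomorphism X X T Ti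
     \<and> (\<forall>x\<in>X. X \<subseteq> closure (orbit T Ti x))"

definition preim :: "'a set \<Rightarrow> ('a \<Rightarrow> 'a) \<Rightarrow> nat \<Rightarrow> 'a set \<Rightarrow> 'a set" where
  "preim X T j A = {x \<in> X. (T ^^ j) x \<in> A}"

text \<open>A partition at level n is given by C n (number of towers), the bases B n k
  (k = 1..C n) and heights h n k.\<close>

definition atoms :: "'a set \<Rightarrow> ('a \<Rightarrow> 'a) \<Rightarrow> (nat \<Rightarrow> nat) \<Rightarrow> (nat \<Rightarrow> nat \<Rightarrow> 'a set)
    \<Rightarrow> (nat \<Rightarrow> nat \<Rightarrow> nat) \<Rightarrow> nat \<Rightarrow> 'a set set" where
  "atoms X T C B h n = {preim X T j (B n k) | k j. k \<in> {1..C n} \<and> j < h n k}"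

definition roof :: "(nat \<Rightarrow> nat) \<Rightarrow> (nat \<Rightarrow> nat \<Rightarrow> 'a set) \<Rightarrow> nat \<Rightarrow> 'a set" where
  "roof C B n = (\<Union>k\<in>{1..C n}. B n k)"

definition is_CKR_partition :: "'a::metric_space set \<Rightarrow> ('a \<Rightarrow> 'a) \<Rightarrow> (nat \<Rightarrow> nat)
    \<Rightarrow> (nat \<Rightarrow> nat \<Rightarrow> 'a set) \<Rightarrow> (nat \<Rightarrow> nat \<Rightarrow> nat) \<Rightarrow> nat \<Rightarrow> bool" where
  "is_CKR_partition X T C B h n \<longleftrightarrow>
     C n \<ge> 1
   \<and> (\<forall>k\<in>{1..C n}. B n k \<subseteq> X \<and> B n k \<noteq> {} \<and> h n k \<ge> 1
        \<and> openin (top_of_set X) (B n k) \<and> closedin (top_of_set X) (B n k))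
   \<and> (\<forall>k\<in>{1..C n}. \<forall>j<h n k. \<forall>k'\<in>{1..C n}. \<forall>j'<h n k'. (k, j) \<noteq> (k', j') \<longrightarrow>
        preim X T j (B n k) \<inter> preim X T j' (B n k') = {})
   \<and> \<Union>(atoms X T C B h n) = X"

definition KR_sequence :: "'a::metric_space set \<Rightarrow> ('a \<Rightarrow> 'a) \<Rightarrow> (nat \<Rightarrow> nat)
    \<Rightarrow> (nat \<Rightarrow> nat \<Rightarrow> 'a set) \<Rightarrow> (nat \<Rightarrow> nat \<Rightarrow> nat) \<Rightarrow> bool" where
  "KR_sequence X T C B h \<longleftrightarrow>
     (\<forall>n. is_CKR_partition X T C B h n)
   \<and> C 0 = 1 \<and> B 0 1 = X \<and> h 0 1 = 1
   \<comment> \<open>(KR1)\<close>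
   \<and> (\<forall>n. roof C B (Suc n) \<subseteq> roof C B n)
   \<comment> \<open>(KR2)\<close>
   \<and> (\<forall>n. \<forall>A\<in>atoms X T C B h (Suc n). \<exists>A'\<in>atoms X T C B h n. A \<subseteq> A')
   \<comment> \<open>(KR3)\<close>
   \<and> (\<exists>x. (\<Inter>n. roof C B n) = {x})
   \<comment> \<open>(KR4)\<close>
   \<and> top_of_set X = topology_generated_by (\<Union>n. atoms X T C B h n)
   \<comment> \<open>(KR5)\<close>
   \<and> (\<forall>n\<ge>1. \<forall>k\<in>{1..C (n - 1)}. \<forall>l\<in>{1..C n}. \<exists>j<h n l. preim X T j (B n l) \<subseteq> B (n - 1) k)
   \<comment> \<open>(KR6)\<close>
   \<and> (\<forall>n\<ge>1. roof C B n \<subseteq> B (n - 1) 1)"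

definition linearly_recurrent_seq :: "(nat \<Rightarrow> nat) \<Rightarrow> (nat \<Rightarrow> nat \<Rightarrow> nat) \<Rightarrow> bool" where
  "linearly_recurrent_seq C h \<longleftrightarrow>
     (\<exists>L::real. \<forall>n\<ge>1. \<forall>l\<in>{1..C n}. \<forall>k\<in>{1..C (n - 1)}. real (h n l) \<le> L * real (h (n - 1) k))"

section \<open>Matrices (indices start at 1; a matrix is a function of (row, column))\<close>

definition Mmat :: "'a set \<Rightarrow> ('a \<Rightarrow> 'a) \<Rightarrow> (nat \<Rightarrow> nat \<Rightarrow> 'a set) \<Rightarrow> (nat \<Rightarrow> nat \<Rightarrow> nat)
    \<Rightarrow> nat \<Rightarrow> nat \<Rightarrow> nat \<Rightarrow> real" where
  "Mmat X T B h n l k = real (card {j. j < h n l \<and> preim X T j (B n l) \<subseteq> B (n - 1) k})"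

definition matmul :: "(nat \<Rightarrow> nat \<Rightarrow> real) \<Rightarrow> nat \<Rightarrow> (nat \<Rightarrow> nat \<Rightarrow> real) \<Rightarrow> nat \<Rightarrow> nat \<Rightarrow> real" where
  "matmul A d D i j = (\<Sum>r\<in>{1..d}. A i r * D r j)"

fun Pmat :: "'a set \<Rightarrow> ('a \<Rightarrow> 'a) \<Rightarrow> (nat \<Rightarrow> nat) \<Rightarrow> (nat \<Rightarrow> nat \<Rightarrow> 'a set) \<Rightarrow> (nat \<Rightarrow> nat \<Rightarrow> nat)
    \<Rightarrow> nat \<Rightarrow> nat \<Rightarrow> nat \<Rightarrow> nat \<Rightarrow> real" where
  "Pmat X T C B h 0 m = (\<lambda>i j. if i = j then 1 else 0)"
| "Pmat X T C B h (Suc n) m =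
     (if Suc n \<le> m then (\<lambda>i j. if i = j then 1 else 0)
      else matmul (Mmat X T B h (Suc n)) (C n) (Pmat X T C B h n m))"

definition PH1 :: "'a set \<Rightarrow> ('a \<Rightarrow> 'a) \<Rightarrow> (nat \<Rightarrow> nat) \<Rightarrow> (nat \<Rightarrow> nat \<Rightarrow> 'a set) \<Rightarrow> (nat \<Rightarrow> nat \<Rightarrow> nat)
    \<Rightarrow> nat \<Rightarrow> nat \<Rightarrow> real" where
  "PH1 X T C B h n l = (\<Sum>k\<in>{1..C 1}. Pmat X T C B h n 1 l k * real (h 1 k))"

definition dnint :: "real \<Rightarrow> real" where
  "dnint x = \<bar>x - of_int (round x)\<bar>"

definition vnorm :: "nat \<Rightarrow> (nat \<Rightarrow> real) \<Rightarrow> real" where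
  "vnorm d v = Max ((\<lambda>i. dnint (v i)) ` {1..d})"

definition invariant_prob :: "'a::metric_space set \<Rightarrow> ('a \<Rightarrow> 'a) \<Rightarrow> 'a measure \<Rightarrow> bool" where
  "invariant_prob X T \<mu> \<longleftrightarrow> sets \<mu> = sets (restrict_space borel X) \<and> prob_space \<mu>
     \<and> T \<in> measurable \<mu> \<mu> \<and> (\<forall>A\<in>sets \<mu>. emeasure \<mu> (T -` A \<inter> space \<mu>) = emeasure \<mu> A)"

definition L2_eigenvalue :: "'a measure \<Rightarrow> ('a \<Rightarrow> 'a) \<Rightarrow> complex \<Rightarrow> bool" where
  "L2_eigenvalue \<mu> T c \<longleftrightarrow> (\<exists>f::'a \<Rightarrow> complex. f \<in> borel_measurable \<mu>
      \<and> integrable \<mu> (\<lambda>x. (cmod (f x))\<^sup>2) \<and> \<not> (AE x in \<mu>. f x = 0)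
      \<and> (AE x in \<mu>. f (T x) = c * f x))"

definition continuous_eigenvalue :: "'a::metric_space set \<Rightarrow> 'a measure \<Rightarrow> ('a \<Rightarrow> 'a) \<Rightarrow> complex \<Rightarrow> bool" where
  "continuous_eigenvalue X \<mu> T c \<longleftrightarrow> (\<exists>f::'a \<Rightarrow> complex. continuous_on X f
      \<and> f \<in> borel_measurable \<mu>
      \<and> integrable \<mu> (\<lambda>x. (cmod (f x))\<^sup>2) \<and> \<not> (AE x in \<mu>. f x = 0)
      \<and> (AE x in \<mu>. f (T x) = c * f x))"

end

theory Submission
  imports Defs
begin

text \<open>Write \<open>r\<^sub>n(x)\<close> for the time \<open>x\<close> needs to reach the roof of level \<open>n\<close>, and \<open>V\<^sub>n\<close> for the
  distance of \<open>\<alpha> H(n)\<close> to the integer vectors. The increment \<open>r\<^bsub>n+1\<^esub> - r\<^sub>n\<close> is a sum of at most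
  \<open>L\<close> heights of level \<open>n\<close>, so \<open>\<alpha> (r\<^bsub>n+1\<^esub> - r\<^sub>n)\<close> is within \<open>L V\<^sub>n\<close> of an integer. Moreover there
  is a time \<open>e\<^sub>n\<close> with \<open>T\<^bsup>-e\<^sub>n\<^esup> B(n+2) \<subseteq> B(n)\<close> and \<open>\<alpha> e\<^sub>n\<close> at distance at least \<open>V\<^sub>n/2\<close> from the
  integers.

  Continuous eigenvalues: if \<open>V\<close> is summable, the phases \<open>\<lambda>\<^bsup>-r\<^sub>n\<^esup>\<close> converge uniformly to an
  eigenfunction. Conversely, the sum of \<open>e\<^sub>n\<close> over any finite set of large \<open>n\<close> of the same parity is
  a return time to a small neighbourhood of one point, so continuity keeps all these sums,
  multiplied by \<open>\<alpha>\<close>, close to the integers; this forces absolute convergence.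

  Measurable eigenvalues: the centred residues of \<open>\<alpha> (r\<^bsub>n+1\<^esub> - r\<^sub>n)\<close> have exponentially decaying
  correlations, because the tower averages of one level are obtained from those of the previous one
  by a stochastic matrix with entries at least \<open>1/L\<close>. If \<open>V\<close> is square summable, their sum
  therefore converges in \<open>L\<^sup>2\<close>, and normalised phases converge along a subsequence. Conversely, the
  conditional expectations of an eigenfunction on the partitions form a martingale whose increments
  are, by linear recurrence, square summable in the supremum norm; comparing two points of \<open>B(n)\<close>
  that are \<open>e\<^sub>n\<close> apart in one tower of level \<open>n+2\<close> shows that these increments dominate \<open>V\<^sub>n\<close>.\<close>

section \<open>Distance to the nearest integer\<close>

definition signed_dnint :: "real \<Rightarrow> real" where
  "signed_dnint x = x - of_int (round x)"

lemma abs_signed_dnint: "\<bar>signed_dnint x\<bar> = dnint x"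
  by (simp add: signed_dnint_def dnint_def)

lemma dnint_nonneg [simp]: "0 \<le> dnint x"
  by (simp add: dnint_def)

lemma dnint_zero [simp]: "dnint 0 = 0"
  by (simp add: dnint_def)

lemma dnint_le_half: "dnint x \<le> 1 / 2"
  unfolding dnint_def using of_int_round_abs_le[of x] by (simp add: abs_minus_commute)

lemma dnint_le_abs_diff_of_int: "dnint x \<le> \<bar>x - of_int z\<bar>"
  unfolding dnint_def using round_diff_minimal[of x z] by simp

lemma dnint_eq_abs_if_le_half:
  assumes "\<bar>x\<bar> \<le> 1 / 2" shows "dnint x = \<bar>x\<bar>"
proof (rule antisym)
  show "dnint x \<le> \<bar>x\<bar>" using dnint_le_abs_diff_of_int[of x 0] by simp
  show "\<bar>x\<bar> \<le> dnint x"
  proof (cases "round x = 0")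
    case False
    hence "1 \<le> \<bar>real_of_int (round x)\<bar>" by linarith
    thus ?thesis unfolding dnint_def using assms by linarith
  qed (simp add: dnint_def)
qed

lemma dnint_add_le: "dnint (x + y) \<le> dnint x + dnint y"
  using dnint_le_abs_diff_of_int[of "x + y" "round x + round y"] unfolding dnint_def by simp

lemma dnint_diff_of_int [simp]: "dnint (x - of_int z) = dnint x"
proof (rule antisym)
  show "dnint (x - of_int z) \<le> dnint x"
    using dnint_le_abs_diff_of_int[of "x - of_int z" "round x - z"] by (simp add: dnint_def)
  show "dnint x \<le> dnint (x - of_int z)"
    using dnint_le_abs_diff_of_int[of x "round (x - of_int z) + z"]
    by (simp add: dnint_def algebra_simps)
qed

lemma dnint_minus [simp]: "dnint (- x) = dnint x"
proof -
  have "dnint (- y) \<le> dnint y" for y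
    using dnint_le_abs_diff_of_int[of "- y" "- round y"] by (simp add: dnint_def)
  from this[of x] this[of "- x"] show ?thesis by simp
qed

lemma dnint_of_nat_mult_le: "dnint (of_nat m * x) \<le> of_nat m * dnint x"
proof (induction m)
  case (Suc m)
  thus ?case using dnint_add_le[of x "of_nat m * x"] by (simp add: distrib_right)
qed simp

lemma dnint_sum_le: "dnint (\<Sum>i\<in>A. f i) \<le> (\<Sum>i\<in>A. dnint (f i))"
proof (induction A rule: infinite_finite_induct)
  case (insert i A)
  thus ?case using dnint_add_le[of "f i" "\<Sum>i\<in>A. f i"] by simp
qed simp_all

lemma dnint_sum_signed_dnint: "dnint (\<Sum>i\<in>A. signed_dnint (f i)) = dnint (\<Sum>i\<in>A. f i)"
  unfolding signed_dnint_def sum_subtractf of_int_sum[symmetric] by (rule dnint_diff_of_int)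

lemma summable_on_abs_if_dnint_sum_le:
  fixes r :: "'i \<Rightarrow> real"
  assumes half: "\<And>i. i \<in> A \<Longrightarrow> \<bar>r i\<bar> \<le> 1 / 2"
    and sums: "\<And>F. finite F \<Longrightarrow> F \<subseteq> A \<Longrightarrow> dnint (\<Sum>i\<in>F. r i) \<le> 1 / 4"
  shows "(\<lambda>i. \<bar>r i\<bar>) summable_on A"
proof -
  have signed: "\<bar>\<Sum>i\<in>F. r i\<bar> \<le> 1 / 4" if "finite F" "F \<subseteq> A" for F
    using that
  proof (induction F)
    case (insert i F)
    have "\<bar>r i\<bar> \<le> 1 / 4" using sums[of "{i}"] dnint_eq_abs_if_le_half half insert.prems by simp
    hence "dnint (\<Sum>i\<in>insert i F. r i) = \<bar>\<Sum>i\<in>insert i F. r i\<bar>"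
      using insert abs_triangle_ineq[of "r i" "\<Sum>i\<in>F. r i"] by (intro dnint_eq_abs_if_le_half) auto
    thus ?case using sums[of "insert i F"] insert by simp
  qed simp
  have "(\<Sum>i\<in>F. \<bar>r i\<bar>) \<le> 1 / 2" if F: "F \<subseteq> A" "finite F" for F
  proof -
    let ?N = "{i \<in> F. r i < 0}"
    have "(\<Sum>i\<in>F. \<bar>r i\<bar>) = (\<Sum>i\<in>F - ?N. \<bar>r i\<bar>) + (\<Sum>i\<in>?N. \<bar>r i\<bar>)"
      using F(2) by (intro sum.subset_diff) auto
    also have "\<dots> = (\<Sum>i\<in>F - ?N. r i) + (\<Sum>i\<in>?N. - r i)"
      by (intro arg_cong2[of _ _ _ _ "(+)"] sum.cong) auto
    also have "\<dots> \<le> \<bar>\<Sum>i\<in>F - ?N. r i\<bar> + \<bar>\<Sum>i\<in>?N. r i\<bar>"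
      by (simp add: sum_negf)
    also have "\<dots> \<le> 1 / 4 + 1 / 4" using F by (intro add_mono signed) auto
    finally show ?thesis by simp
  qed
  thus ?thesis
    by (intro nonneg_bdd_above_summable_on bdd_aboveI2[where M = "1 / 2"]) auto
qed

section \<open>The additive character of the circle\<close>

definition unit_char :: "real \<Rightarrow> complex" where
  "unit_char t = cis (2 * pi * t)"

lemma unit_char_0 [simp]: "unit_char 0 = 1"
  by (simp add: unit_char_def)

lemma norm_unit_char [simp]: "norm (unit_char t) = 1"
  by (simp add: unit_char_def)

lemma unit_char_nonzero [simp]: "unit_char t \<noteq> 0"
  by (simp add: unit_char_def)

lemma unit_char_add: "unit_char (s + t) = unit_char s * unit_char t"
  by (simp add: unit_char_def cis_mult ring_distribs)

lemma unit_char_minus: "unit_char (- t) = inverse (unit_char t)"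
  by (simp add: unit_char_def flip: cis_inverse)

lemma unit_char_diff_of_int [simp]: "unit_char (t - of_int z) = unit_char t"
  using unit_char_add[of "t - of_int z" "of_int z"] cis_multiple_2pi[of "of_int z"]
  by (simp add: unit_char_def)

lemma unit_char_signed_dnint [simp]: "unit_char (signed_dnint t) = unit_char t"
  by (simp add: signed_dnint_def)

lemma norm_unit_char_minus_one: "norm (unit_char t - 1) = 2 * sin (pi * dnint t)"
proof -
  have "norm (unit_char t - 1) = norm (unit_char (signed_dnint t) - 1)" by simp
  also have "\<dots> = 2 * \<bar>sin (pi * signed_dnint t)\<bar>"
    using dist_exp_i_1[of "2 * pi * signed_dnint t"] by (simp add: unit_char_def cis_conv_exp)
  also have "\<bar>sin (pi * signed_dnint t)\<bar> = \<bar>sin (pi * dnint t)\<bar>"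
    by (cases "0 \<le> signed_dnint t") (simp_all flip: abs_signed_dnint)
  also have "0 \<le> sin (pi * dnint t)"
    using dnint_le_half[of t] by (intro sin_ge_zero) auto
  hence "\<bar>sin (pi * dnint t)\<bar> = sin (pi * dnint t)" by simp
  finally show ?thesis .
qed

lemma norm_unit_char_minus_one_le: "norm (unit_char t - 1) \<le> 2 * pi * dnint t"
  unfolding norm_unit_char_minus_one using sin_x_le_x[of "pi * dnint t"] by simp

lemma Jordan_sin_ge:
  fixes t :: real
  assumes "0 \<le> t" "t \<le> 1" shows "t \<le> sin (pi / 2 * t)"
proof -
  have "concave_on {0..pi} (sin :: real \<Rightarrow> real)"
    by (rule f''_le0_imp_concave[of _ _ cos "\<lambda>x. - sin x"])
      (auto intro!: derivative_eq_intros sin_ge_zero)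
  from concave_onD[OF this, of t 0 "pi / 2"] assms show ?thesis by (simp add: mult.commute)
qed

lemma dnint_le_norm_unit_char_minus_one: "4 * dnint t \<le> norm (unit_char t - 1)"
  unfolding norm_unit_char_minus_one
  using Jordan_sin_ge[of "2 * dnint t"] dnint_le_half[of t] by simp

section \<open>Weighted sums and quadratic forms\<close>

lemma sum_weighted_norm_diff_square:
  fixes z :: "'i \<Rightarrow> 'v::real_inner"
  assumes "(\<Sum>t\<in>I. p t *\<^sub>R z t) = (\<Sum>t\<in>I. p t) *\<^sub>R w"
  shows "(\<Sum>t\<in>I. p t * (norm (z t - w))\<^sup>2)
       = (\<Sum>t\<in>I. p t * (norm (z t))\<^sup>2) - (\<Sum>t\<in>I. p t) * (norm w)\<^sup>2"
proof -
  have "(\<Sum>t\<in>I. p t * (norm (z t - w))\<^sup>2)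
      = (\<Sum>t\<in>I. p t * (norm (z t))\<^sup>2 - 2 * (p t *\<^sub>R z t \<bullet> w) + p t * (norm w)\<^sup>2)"
    by (intro sum.cong) (simp_all add: power2_norm_eq_inner inner_diff inner_commute algebra_simps)
  also have "\<dots> = (\<Sum>t\<in>I. p t * (norm (z t))\<^sup>2) - 2 * ((\<Sum>t\<in>I. p t *\<^sub>R z t) \<bullet> w)
      + (\<Sum>t\<in>I. p t) * (norm w)\<^sup>2"
    by (simp only: sum.distrib sum_subtractf inner_sum_left sum_distrib_left sum_distrib_right)
  also have "(\<Sum>t\<in>I. p t *\<^sub>R z t) \<bullet> w = (\<Sum>t\<in>I. p t) * (norm w)\<^sup>2"
    unfolding assms by (simp add: power2_norm_eq_inner)
  finally show ?thesis by simp
qed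

lemma convex_sum_le:
  fixes x :: "'i \<Rightarrow> real"
  assumes I: "finite I" "i \<in> I"
    and w: "\<And>j. j \<in> I \<Longrightarrow> 0 \<le> w j" "(\<Sum>j\<in>I. w j) = 1" "\<delta> \<le> w i"
    and upper: "\<And>j. j \<in> I \<Longrightarrow> x j \<le> M"
  shows "(\<Sum>j\<in>I. w j * x j) \<le> M - \<delta> * (M - x i)"
proof -
  have "\<delta> * (M - x i) \<le> w i * (M - x i)" using w(3) upper I by (intro mult_right_mono) auto
  also have "\<dots> \<le> (\<Sum>j\<in>I. w j * (M - x j))" using w(1) upper I by (intro member_le_sum) auto
  also have "\<dots> = M - (\<Sum>j\<in>I. w j * x j)"
    using w(2) by (simp add: right_diff_distrib sum_subtractf flip: sum_distrib_right)
  finally show ?thesis by simp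
qed

lemma abs_diff_convex_sums_le:
  fixes x :: "'i \<Rightarrow> real"
  assumes I: "finite I" "i \<in> I"
    and u: "\<And>j. j \<in> I \<Longrightarrow> 0 \<le> u j" "(\<Sum>j\<in>I. u j) = 1" "\<delta> \<le> u i"
    and v: "\<And>j. j \<in> I \<Longrightarrow> 0 \<le> v j" "(\<Sum>j\<in>I. v j) = 1" "\<delta> \<le> v i"
    and osc: "\<And>j k. j \<in> I \<Longrightarrow> k \<in> I \<Longrightarrow> \<bar>x j - x k\<bar> \<le> D"
  shows "\<bar>(\<Sum>j\<in>I. u j * x j) - (\<Sum>j\<in>I. v j * x j)\<bar> \<le> (1 - \<delta>) * D"
proof -
  have "I \<noteq> {}" using I by blast
  obtain a where a: "a \<in> I" "\<And>j. j \<in> I \<Longrightarrow> x a \<le> x j"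
    using arg_min_if_finite(1)[of I x] arg_min_least[of I _ x] I \<open>I \<noteq> {}\<close> by blast
  obtain b where b: "b \<in> I" "\<And>j. j \<in> I \<Longrightarrow> x j \<le> x b"
    using arg_min_if_finite(1)[of I "\<lambda>j. - x j"] arg_min_least[of I _ "\<lambda>j. - x j"] I \<open>I \<noteq> {}\<close>
    by fastforce
  have upper: "(\<Sum>j\<in>I. w j * x j) \<le> x b - \<delta> * (x b - x i)"
    and lower: "x a + \<delta> * (x i - x a) \<le> (\<Sum>j\<in>I. w j * x j)"
    if w: "\<And>j. j \<in> I \<Longrightarrow> 0 \<le> w j" "(\<Sum>j\<in>I. w j) = 1" "\<delta> \<le> w i" for w
    using convex_sum_le[OF I w b(2)] convex_sum_le[of I i w \<delta> "\<lambda>j. - x j" "- x a"] I w a(2)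
    by (simp_all add: sum_negf algebra_simps)
  have "\<delta> \<le> 1" using u(3) member_le_sum[of i I u] I u by auto
  hence "(1 - \<delta>) * (x b - x a) \<le> (1 - \<delta>) * D"
    using osc[OF b(1) a(1)] by (intro mult_left_mono) auto
  thus ?thesis
    using upper[OF u] upper[OF v] lower[OF u] lower[OF v] by (auto simp: abs_le_iff algebra_simps)
qed

lemma Schur_quadratic_form_le:
  fixes t :: "'i \<Rightarrow> 'i \<Rightarrow> real"
  assumes nonneg: "\<And>n m. 0 \<le> t n m" and sym: "\<And>n m. t n m = t m n"
    and row: "\<And>n. n \<in> A \<Longrightarrow> (\<Sum>m\<in>A. t n m) \<le> R"
  shows "(\<Sum>n\<in>A. \<Sum>m\<in>A. t n m * (x n * x m)) \<le> R * (\<Sum>n\<in>A. (x n)\<^sup>2)"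
proof -
  let ?S = "\<Sum>n\<in>A. \<Sum>m\<in>A. t n m * (x n)\<^sup>2 / 2"
  have "(\<Sum>n\<in>A. \<Sum>m\<in>A. t n m * (x n * x m))
      \<le> (\<Sum>n\<in>A. \<Sum>m\<in>A. t n m * (x n)\<^sup>2 / 2 + t m n * (x m)\<^sup>2 / 2)"
  proof (intro sum_mono)
    fix n m
    have "x n * x m \<le> ((x n)\<^sup>2 + (x m)\<^sup>2) / 2"
      using zero_le_power2[of "x n - x m"] by (simp add: power2_diff)
    from mult_left_mono[OF this nonneg[of n m]]
    show "t n m * (x n * x m) \<le> t n m * (x n)\<^sup>2 / 2 + t m n * (x m)\<^sup>2 / 2"
      unfolding sym[of m n] by (simp add: field_simps)
  qed
  also have "\<dots> = ?S + (\<Sum>n\<in>A. \<Sum>m\<in>A. t m n * (x m)\<^sup>2 / 2)"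
    by (simp only: sum.distrib)
  also have "(\<Sum>n\<in>A. \<Sum>m\<in>A. t m n * (x m)\<^sup>2 / 2) = ?S"
    by (rule sum.swap)
  also have "?S + ?S = (\<Sum>n\<in>A. (\<Sum>m\<in>A. t n m) * (x n)\<^sup>2)"
    by (simp add: sum_distrib_right flip: sum.distrib)
  also have "\<dots> \<le> (\<Sum>n\<in>A. R * (x n)\<^sup>2)"
    by (intro sum_mono mult_right_mono row) auto
  finally show ?thesis by (simp add: sum_distrib_left)
qed

lemma sum_power_dist_le:
  fixes \<theta> :: real
  assumes A: "finite A" and \<theta>: "0 \<le> \<theta>" "\<theta> < 1"
  shows "(\<Sum>m\<in>A. \<theta> ^ nat \<bar>int n - int m\<bar>) \<le> 2 / (1 - \<theta>)"
proof -
  let ?d = "\<lambda>m. nat \<bar>int n - int m\<bar>"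
  have geometric: "(\<Sum>m\<in>J. \<theta> ^ f m) \<le> 1 / (1 - \<theta>)"
    if "finite J" "inj_on f J" for J and f :: "nat \<Rightarrow> nat"
  proof -
    have "(\<Sum>m\<in>J. \<theta> ^ f m) = (\<Sum>j\<in>f ` J. \<theta> ^ j)" using that(2) by (simp add: sum.reindex)
    also have "\<dots> \<le> (\<Sum>j. \<theta> ^ j)" using \<theta> that(1) by (intro sum_le_suminf) auto
    also have "\<dots> = 1 / (1 - \<theta>)" using \<theta> by (simp add: suminf_geometric)
    finally show ?thesis .
  qed
  have "(\<Sum>m\<in>A. \<theta> ^ ?d m) = (\<Sum>m\<in>A \<inter> {..n}. \<theta> ^ ?d m) + (\<Sum>m\<in>A - {..n}. \<theta> ^ ?d m)"
    by (rule sum.Int_Diff[OF A])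
  also have "\<dots> \<le> 1 / (1 - \<theta>) + 1 / (1 - \<theta>)"
    using A by (intro add_mono geometric) (auto simp: inj_on_def)
  finally show ?thesis by simp
qed

section \<open>Integrals in finite measure spaces\<close>

lemma integrable_imp_set_integrable:
  fixes f :: "'a \<Rightarrow> 'b::{banach, second_countable_topology}"
  shows "integrable M f \<Longrightarrow> A \<in> sets M \<Longrightarrow> set_integrable M A f"
  unfolding set_integrable_def by (rule integrable_mult_indicator)

lemma (in finite_measure) set_integral_norm_square_ge:
  fixes f :: "'a \<Rightarrow> 'v::{real_inner, banach, second_countable_topology}"
  assumes f: "integrable M f" "integrable M (\<lambda>x. (norm (f x))\<^sup>2)" and A: "A \<in> sets M"
    and mean: "(LINT x:A|M. f x) = measure M A *\<^sub>R w"
  shows "measure M A * (norm w)\<^sup>2 \<le> (LINT x:A|M. (norm (f x))\<^sup>2)"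
proof -
  have square: "set_integrable M A (\<lambda>x. (norm (f x))\<^sup>2)"
    and const: "set_integrable M A (\<lambda>_. (norm w)\<^sup>2)"
    and product: "set_integrable M A (\<lambda>x. 2 * (f x \<bullet> w))"
    using f A by (auto intro!: integrable_imp_set_integrable)
  have "(\<lambda>x. indicator A x *\<^sub>R (f x \<bullet> w)) = (\<lambda>x. (indicator A x *\<^sub>R f x) \<bullet> w)" by simp
  hence inner: "(LINT x:A|M. f x \<bullet> w) = (LINT x:A|M. f x) \<bullet> w"
    using integrable_imp_set_integrable[OF f(1) A]
    unfolding set_lebesgue_integral_def set_integrable_def by (simp only: integral_inner_left)
  have "0 \<le> (LINT x:A|M. (norm (f x - w))\<^sup>2)"
    unfolding set_lebesgue_integral_def by (intro integral_nonneg_AE) auto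
  also have "\<dots> = (LINT x:A|M. (norm (f x))\<^sup>2 + (norm w)\<^sup>2 - 2 * (f x \<bullet> w))"
    by (simp add: power2_norm_eq_inner inner_diff inner_commute)
  also have "\<dots> = (LINT x:A|M. (norm (f x))\<^sup>2) + measure M A * (norm w)\<^sup>2
      - 2 * ((LINT x:A|M. f x) \<bullet> w)"
    using square const product A by (simp add: set_integral_add set_integral_const inner)
  also have "(LINT x:A|M. f x) \<bullet> w = measure M A * (norm w)\<^sup>2"
    unfolding mean by (simp add: power2_norm_eq_inner)
  finally show ?thesis by simp
qed

lemma (in sigma_finite_measure) AE_zero_if_generator_integrals_zero:
  fixes f :: "'a \<Rightarrow> 'b::{banach, second_countable_topology}"
  assumes f: "integrable M f"
    and G: "Int_stable G" "G \<subseteq> Pow (space M)" "sets M = sigma_sets (space M) G"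
    and zero: "(LINT x|M. f x) = 0" "\<And>A. A \<in> G \<Longrightarrow> (LINT x:A|M. f x) = 0"
  shows "AE x in M. f x = 0"
proof (rule density_zero[OF f])
  fix A assume A: "A \<in> sets M"
  show "(LINT x:A|M. f x) = 0"
  proof (rule sigma_sets_induct_disjoint[OF G(1,2) A[unfolded G(3)]])
    fix A assume "A \<in> G"
    thus "(LINT x:A|M. f x) = 0" by (rule zero(2))
  next
    show "(LINT x:{}|M. f x) = 0" by (simp add: set_lebesgue_integral_def)
  next
    fix A assume A: "A \<in> sigma_sets (space M) G" "(LINT x:A|M. f x) = 0"
    have "(LINT x:space M|M. f x) = (LINT x:A \<union> (space M - A)|M. f x)"
      using sets.sets_into_space[of A M] A(1) G(3) by (simp add: Un_absorb1)
    also have "\<dots> = (LINT x:A|M. f x) + (LINT x:space M - A|M. f x)"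
      using A(1) G(3) by (intro set_integral_Un integrable_imp_set_integrable f) auto
    finally show "(LINT x:space M - A|M. f x) = 0"
      using A(2) zero(1) f by (simp add: set_integral_space)
  next
    fix A :: "nat \<Rightarrow> 'a set"
    assume A: "disjoint_family A" "range A \<subseteq> sigma_sets (space M) G" "\<And>i. (LINT x:A i|M. f x) = 0"
    have "A i \<in> sets M" for i using A(2) G(3) by blast
    hence "(LINT x:(\<Union>i. A i)|M. f x) = (\<Sum>i. LINT x:A i|M. f x)"
      using A(1) by (intro lebesgue_integral_countable_add integrable_imp_set_integrable f)
        (auto simp: disjoint_family_on_def)
    thus "(LINT x:(\<Union>i. A i)|M. f x) = 0" using A(3) by simp
  qed
qed

lemma (in prob_space) expectation_abs_square_le:
  fixes g :: "'a \<Rightarrow> real"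
  assumes "integrable M g" "integrable M (\<lambda>x. (g x)\<^sup>2)"
  shows "(expectation (\<lambda>x. \<bar>g x\<bar>))\<^sup>2 \<le> expectation (\<lambda>x. (g x)\<^sup>2)"
  using variance_eq[of "\<lambda>x. \<bar>g x\<bar>"] variance_positive[of "\<lambda>x. \<bar>g x\<bar>"] assms by simp

lemma (in prob_space) L2_Cauchy_imp_AE_convergent_subseq:
  fixes G :: "nat \<Rightarrow> 'a \<Rightarrow> real"
  assumes int: "\<And>n. integrable M (G n)" "\<And>n m. integrable M (\<lambda>x. (G n x - G m x)\<^sup>2)"
    and cauchy: "\<And>e. 0 < e \<Longrightarrow> \<exists>N. \<forall>n\<ge>N. \<forall>m\<ge>N. expectation (\<lambda>x. (G n x - G m x)\<^sup>2) < e"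
  obtains r where "strict_mono r" "AE x in M. convergent (\<lambda>i. G (r i) x)"
proof (rule cauchy_L1_AE_cauchy_subseq[of M G])
  show "integrable M (G n)" for n by (rule int)
next
  fix e :: real assume "0 < e"
  then obtain N where N: "\<And>n m. N \<le> n \<Longrightarrow> N \<le> m \<Longrightarrow> expectation (\<lambda>x. (G n x - G m x)\<^sup>2) < e\<^sup>2"
    using cauchy[of "e\<^sup>2"] by auto
  have "expectation (\<lambda>x. norm (G n x - G m x)) < e" if "N \<le> n" "N \<le> m" for n m
  proof (rule power2_less_imp_less)
    have "(expectation (\<lambda>x. norm (G n x - G m x)))\<^sup>2 \<le> expectation (\<lambda>x. (G n x - G m x)\<^sup>2)"
      using expectation_abs_square_le[of "\<lambda>x. G n x - G m x"] int by simp
    also have "\<dots> < e\<^sup>2" using that by (rule N)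
    finally show "(expectation (\<lambda>x. norm (G n x - G m x)))\<^sup>2 < e\<^sup>2" .
  qed (use \<open>0 < e\<close> in simp)
  thus "\<exists>N. \<forall>n\<ge>N. \<forall>m\<ge>N. expectation (\<lambda>x. norm (G n x - G m x)) < e" by blast
next
  fix r assume r: "strict_mono r" "AE x in M. Cauchy (\<lambda>i. G (r i) x)"
  from r(2) have "AE x in M. convergent (\<lambda>i. G (r i) x)"
    by eventually_elim (rule Cauchy_convergent)
  with r(1) show thesis by (rule that)
qed

lemma (in prob_space) L2_series_AE_convergent_subseq:
  fixes g :: "nat \<Rightarrow> 'a \<Rightarrow> real"
  assumes int: "\<And>n. integrable M (g n)" "\<And>n m. integrable M (\<lambda>x. g n x * g m x)"
    and second_moment: "\<And>A. finite A \<Longrightarrow> expectation (\<lambda>x. (\<Sum>n\<in>A. g n x)\<^sup>2) \<le> (\<Sum>n\<in>A. c n)"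
    and "summable c"
  obtains r where "strict_mono r" "AE x in M. convergent (\<lambda>i. \<Sum>n<r i. g n x)"
proof (rule L2_Cauchy_imp_AE_convergent_subseq[of "\<lambda>i x. \<Sum>n<i. g n x"])
  have diff: "((\<Sum>n<m. g n x) - (\<Sum>n<k. g n x))\<^sup>2 = (\<Sum>n=min k m..<max k m. g n x)\<^sup>2" for k m x
  proof -
    have "(\<Sum>n<m. g n x) - (\<Sum>n<k. g n x) = (\<Sum>n=k..<m. g n x)" if "k \<le> m" for k m
      using sum_diff_nat_ivl[of 0 k m "\<lambda>n. g n x"] that by (simp add: lessThan_atLeast0)
    from this[of k m] this[of m k] show ?thesis
      by (cases "k \<le> m") (simp_all add: power2_commute[of "\<Sum>n<m. g n x"])
  qed
  show "integrable M (\<lambda>x. ((\<Sum>n<m. g n x) - (\<Sum>n<k. g n x))\<^sup>2)" for k m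
    unfolding diff unfolding power2_eq_square sum_product
    by (intro Bochner_Integration.integrable_sum int)
  show "integrable M (\<lambda>x. \<Sum>n<i. g n x)" for i
    by (intro Bochner_Integration.integrable_sum int)
  fix e :: real assume "0 < e"
  then obtain N where N: "\<And>m n. N \<le> m \<Longrightarrow> norm (\<Sum>k=m..<n. c k) < e"
    using \<open>summable c\<close>[unfolded summable_Cauchy] by blast
  have "expectation (\<lambda>x. ((\<Sum>n<m. g n x) - (\<Sum>n<k. g n x))\<^sup>2) < e" if "N \<le> m" "N \<le> k" for m k
    unfolding diff using second_moment[of "{min k m..<max k m}"] N[of "min k m" "max k m"] that
    by simp
  thus "\<exists>N. \<forall>m\<ge>N. \<forall>k\<ge>N. expectation (\<lambda>x. ((\<Sum>n<m. g n x) - (\<Sum>n<k. g n x))\<^sup>2) < e" by blast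
qed (rule that)

section \<open>Homeomorphisms and their orbits\<close>

locale homeomorphic_system =
  fixes X :: "'a::t1_space set" and T Ti :: "'a \<Rightarrow> 'a"
  assumes homeo: "homeomorphism X X T Ti"
begin

lemma T_in: "x \<in> X \<Longrightarrow> T x \<in> X" and Ti_in: "x \<in> X \<Longrightarrow> Ti x \<in> X"
  using homeo by (auto simp: homeomorphism_def)

lemma T_Ti: "x \<in> X \<Longrightarrow> T (Ti x) = x" and Ti_T: "x \<in> X \<Longrightarrow> Ti (T x) = x"
  using homeo by (auto simp: homeomorphism_def)

lemma funpow_in: "x \<in> X \<Longrightarrow> (T ^^ j) x \<in> X"
  by (induction j) (auto simp: T_in)

lemma funpow_surj:
  assumes "y \<in> X" obtains x where "x \<in> X" "(T ^^ j) x = y"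
proof -
  have "\<exists>x\<in>X. (T ^^ j) x = y" using assms
  proof (induction j arbitrary: y)
    case (Suc j)
    from Suc.IH[OF Ti_in[OF Suc.prems]] obtain x where "x \<in> X" "(T ^^ j) x = Ti y" by blast
    thus ?case using T_Ti[OF Suc.prems] by (intro bexI[of _ x]) auto
  qed auto
  thus ?thesis using that by blast
qed

lemma Ti_funpow_cancel: "x \<in> X \<Longrightarrow> (Ti ^^ j) ((T ^^ j) x) = x"
proof (induction j arbitrary: x)
  case (Suc j)
  have "(Ti ^^ Suc j) ((T ^^ Suc j) x) = (Ti ^^ j) (Ti (T ((T ^^ j) x)))"
    by (simp add: funpow_swap1)
  thus ?case using Suc Ti_T[OF funpow_in[OF Suc.prems]] by simp
qed simp

lemma continuous_on_funpow: "continuous_on X (T ^^ j)"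
proof (induction j)
  case (Suc j)
  have "continuous_on ((T ^^ j) ` X) T"
    using homeo funpow_in by (auto simp: homeomorphism_def intro: continuous_on_subset)
  from continuous_on_compose[OF Suc this] show ?case by (simp add: comp_def)
qed (simp add: continuous_on_id)

lemma preim_subset: "preim X T j A \<subseteq> X"
  by (auto simp: preim_def)

lemma preim_0: "A \<subseteq> X \<Longrightarrow> preim X T 0 A = A"
  by (auto simp: preim_def)

lemma mem_preim_add: "x \<in> X \<Longrightarrow> x \<in> preim X T (i + j) A \<longleftrightarrow> (T ^^ j) x \<in> preim X T i A"
  by (simp add: preim_def funpow_in funpow_add)

lemma preim_nonempty: "A \<subseteq> X \<Longrightarrow> A \<noteq> {} \<Longrightarrow> preim X T j A \<noteq> {}"
  by (auto simp: preim_def) (metis funpow_surj subset_iff)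

lemma openin_preim:
  assumes "openin (top_of_set X) A" shows "openin (top_of_set X) (preim X T j A)"
proof -
  have "openin (top_of_set X) (X \<inter> (T ^^ j) -` A)"
    using funpow_in assms by (intro continuous_openin_preimage[OF continuous_on_funpow]) auto
  thus ?thesis by (simp add: preim_def Int_def vimage_def)
qed

lemma dense_orbit_aperiodic:
  assumes x: "x \<in> X" and dense: "X \<subseteq> closure (orbit T Ti x)" and "infinite X" and "0 < p"
  shows "(T ^^ p) x \<noteq> x"
proof
  assume period: "(T ^^ p) x = x"
  have Ti_period: "(Ti ^^ p) x = x" using Ti_funpow_cancel[OF x, of p] period by simp
  have "orbit T Ti x \<subseteq> (\<lambda>m. (T ^^ m) x) ` {..<p} \<union> (\<lambda>m. (Ti ^^ m) x) ` {..<p}"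
    unfolding orbit_def using funpow_mod_eq[OF period] funpow_mod_eq[OF Ti_period] \<open>0 < p\<close>
    by (auto simp: image_iff) (metis lessThan_iff mod_less_divisor)+
  hence finite_orbit: "finite (orbit T Ti x)" by (rule finite_subset) auto
  hence "X \<subseteq> orbit T Ti x" using dense finite_imp_closed by (metis closure_closed)
  thus False using finite_orbit \<open>infinite X\<close> finite_subset by blast
qed

lemma dense_orbit_eigen_zero:
  fixes f :: "'a \<Rightarrow> 'b::real_normed_field"
  assumes f: "continuous_on X f" and eigen: "\<And>y. y \<in> X \<Longrightarrow> f (T y) = c * f y" and "c \<noteq> 0"
    and x: "x \<in> X" "f x = 0" and dense: "X \<subseteq> closure (orbit T Ti x)" and y: "y \<in> X"
  shows "f y = 0"
proof -
  have "(T ^^ n) x \<in> X \<and> f ((T ^^ n) x) = 0" for n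
    using x by (induction n) (auto simp: T_in eigen)
  moreover have "(Ti ^^ n) x \<in> X \<and> f ((Ti ^^ n) x) = 0" for n
  proof (induction n)
    case (Suc n)
    thus ?case using eigen[of "Ti ((Ti ^^ n) x)"] \<open>c \<noteq> 0\<close> by (simp add: Ti_in T_Ti)
  qed (use x in simp)
  ultimately have orbit: "orbit T Ti x \<subseteq> {y \<in> X. f y = 0}" by (auto simp: orbit_def)
  have "closedin (top_of_set X) {y \<in> X. f y = 0}"
    by (rule continuous_closedin_preimage_constant[OF f])
  then obtain S where S: "closed S" "{y \<in> X. f y = 0} = X \<inter> S" unfolding closedin_closed by blast
  hence "closure (orbit T Ti x) \<subseteq> S" using orbit by (intro closure_minimal) auto
  thus ?thesis using dense S(2) y by blast
qed

end

section \<open>Kakutani--Rohlin towers\<close>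

locale kakutani_rohlin = homeomorphic_system X T Ti
  for X :: "'a::metric_space set" and T Ti :: "'a \<Rightarrow> 'a" +
  fixes C :: "nat \<Rightarrow> nat" and B :: "nat \<Rightarrow> nat \<Rightarrow> 'a set" and h :: "nat \<Rightarrow> nat \<Rightarrow> nat"
  assumes KR_sequence: "KR_sequence X T C B h"
begin

definition towers :: "nat \<Rightarrow> nat set" where
  "towers n = {1..C n}"

abbreviation "atom n k j \<equiv> preim X T j (B n k)"

lemma CKR_partition: "is_CKR_partition X T C B h n"
  using KR_sequence by (simp add: KR_sequence_def)

lemma finite_towers [simp]: "finite (towers n)"
  by (simp add: towers_def)

lemma one_in_towers [simp]: "1 \<in> towers n" and Suc_0_in_towers [simp]: "Suc 0 \<in> towers n"
  using CKR_partition[of n] by (auto simp: is_CKR_partition_def towers_def)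

lemma towers_nonempty [simp]: "towers n \<noteq> {}"
  using one_in_towers by blast

lemma
  assumes "k \<in> towers n"
  shows base_subset: "B n k \<subseteq> X" and base_nonempty: "B n k \<noteq> {}" and height_pos: "0 < h n k"
    and openin_base: "openin (top_of_set X) (B n k)"
  using CKR_partition[of n] assms unfolding is_CKR_partition_def towers_def
  by (auto simp: Suc_le_eq)

lemma base_subset_roof: "k \<in> towers n \<Longrightarrow> B n k \<subseteq> roof C B n"
  by (auto simp: roof_def towers_def)

lemma roofE: assumes "x \<in> roof C B n" obtains k where "k \<in> towers n" "x \<in> B n k"
  using assms by (auto simp: roof_def towers_def)

lemma roof_subset: "roof C B n \<subseteq> X"
  using base_subset by (blast elim: roofE)

lemma roof_Suc_subset: "roof C B (Suc n) \<subseteq> roof C B n"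
  using KR_sequence by (simp add: KR_sequence_def)

lemma roof_antimono: "m \<le> n \<Longrightarrow> roof C B n \<subseteq> roof C B m"
  by (rule lift_Suc_antimono_le[of "roof C B"]) (auto simp: roof_Suc_subset)

lemma roof_Suc_subset_base: "roof C B (Suc n) \<subseteq> B n 1"
  using KR_sequence unfolding KR_sequence_def
  by (metis One_nat_def diff_Suc_1 le_add1 plus_1_eq_Suc)

lemma atom_0: "k \<in> towers n \<Longrightarrow> atom n k 0 = B n k"
  by (simp add: preim_0 base_subset)

lemma atom_nonempty: "k \<in> towers n \<Longrightarrow> atom n k j \<noteq> {}"
  by (simp add: preim_nonempty base_subset base_nonempty)

lemma atom_unique:
  assumes "k \<in> towers n" "j < h n k" "k' \<in> towers n" "j' < h n k'"
    and "x \<in> atom n k j" "x \<in> atom n k' j'"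
  shows "k = k' \<and> j = j'"
proof (rule ccontr)
  assume "\<not> ?thesis"
  hence "atom n k j \<inter> atom n k' j' = {}"
    using CKR_partition[of n] assms(1-4) unfolding is_CKR_partition_def towers_def by blast
  with assms(5,6) show False by blast
qed

lemma atoms_eq: "atoms X T C B h n = {atom n k j | k j. k \<in> towers n \<and> j < h n k}"
  by (simp add: atoms_def towers_def)

lemma Union_atoms: "(\<Union>k\<in>towers n. \<Union>j<h n k. atom n k j) = X"
proof -
  have "(\<Union>k\<in>towers n. \<Union>j<h n k. atom n k j) = \<Union>(atoms X T C B h n)" unfolding atoms_eq by blast
  also have "\<dots> = X" using CKR_partition[of n] by (simp add: is_CKR_partition_def)
  finally show ?thesis .
qed

lemma atom_refine:
  assumes "l \<in> towers (Suc n)" "j < h (Suc n) l"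
  obtains k i where "k \<in> towers n" "i < h n k" "atom (Suc n) l j \<subseteq> atom n k i"
proof -
  have "atom (Suc n) l j \<in> atoms X T C B h (Suc n)"
    using assms unfolding atoms_eq by blast
  moreover have "\<forall>A\<in>atoms X T C B h (Suc n). \<exists>A'\<in>atoms X T C B h n. A \<subseteq> A'"
    using KR_sequence by (simp add: KR_sequence_def)
  ultimately obtain A' where "A' \<in> atoms X T C B h n" "atom (Suc n) l j \<subseteq> A'" by blast
  thus ?thesis using that unfolding atoms_eq by blast
qed

subsection \<open>Entry times\<close>

text \<open>Outside \<open>X\<close> the values of \<open>entry_time\<close> and \<open>tower_of\<close> are junk.\<close>

definition entry_time :: "nat \<Rightarrow> 'a \<Rightarrow> nat" where
  "entry_time n x = (LEAST j. (T ^^ j) x \<in> roof C B n)"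

definition tower_of :: "nat \<Rightarrow> 'a \<Rightarrow> nat" where
  "tower_of n x = (THE k. k \<in> towers n \<and> (T ^^ entry_time n x) x \<in> B n k)"

lemma entry_time_le: "(T ^^ j) x \<in> roof C B n \<Longrightarrow> entry_time n x \<le> j"
  unfolding entry_time_def by (rule Least_le)

lemma
  assumes k: "k \<in> towers n" and j: "j < h n k" and x: "x \<in> atom n k j"
  shows entry_time_eq: "entry_time n x = j" and tower_of_eq: "tower_of n x = k"
proof -
  have x_in: "x \<in> X" and base: "(T ^^ j) x \<in> B n k" using x by (auto simp: preim_def)
  show entry: "entry_time n x = j"
    unfolding entry_time_def
  proof (rule Least_equality)
    show "(T ^^ j) x \<in> roof C B n" using base base_subset_roof[OF k] by blast
    fix i assume "(T ^^ i) x \<in> roof C B n"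
    then obtain k' where k': "k' \<in> towers n" "(T ^^ i) x \<in> B n k'" by (rule roofE)
    hence mem_0: "(T ^^ i) x \<in> atom n k' 0" by (simp add: atom_0)
    show "j \<le> i"
    proof (rule ccontr)
      assume "\<not> j \<le> i"
      hence "(T ^^ i) x \<in> atom n k (j - i)" "j - i < h n k" "j - i \<noteq> 0"
        using mem_preim_add[OF x_in, of "j - i" i "B n k"] x j by simp_all
      thus False using atom_unique[OF k _ k'(1) height_pos[OF k'(1)] _ mem_0, of "j - i"] by simp
    qed
  qed
  show "tower_of n x = k"
    unfolding tower_of_def entry
  proof (rule the_equality)
    fix k' assume k': "k' \<in> towers n \<and> (T ^^ j) x \<in> B n k'"
    hence "(T ^^ j) x \<in> atom n k' 0" "(T ^^ j) x \<in> atom n k 0"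
      using k base by (simp_all add: atom_0)
    thus "k' = k" using atom_unique[of k' n 0 k 0] k k' height_pos by simp
  qed (use k base in blast)
qed

lemma
  assumes "x \<in> X"
  shows tower_of_in: "tower_of n x \<in> towers n"
    and entry_time_less: "entry_time n x < h n (tower_of n x)"
    and mem_cell: "x \<in> atom n (tower_of n x) (entry_time n x)"
proof -
  obtain k j where "k \<in> towers n" "j < h n k" "x \<in> atom n k j"
    using Union_atoms[of n] assms by blast
  thus "tower_of n x \<in> towers n" "entry_time n x < h n (tower_of n x)"
      "x \<in> atom n (tower_of n x) (entry_time n x)"
    by (simp_all add: entry_time_eq tower_of_eq)
qed

lemma tower_of_base: "k \<in> towers n \<Longrightarrow> x \<in> B n k \<Longrightarrow> tower_of n x = k"
  using tower_of_eq[of k n 0 x] by (simp add: height_pos atom_0)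

lemma funpow_entry_time: "x \<in> X \<Longrightarrow> (T ^^ entry_time n x) x \<in> B n (tower_of n x)"
  using mem_cell[of x n] by (simp add: preim_def)

lemma entry_time_eq_0_iff:
  assumes "x \<in> X" shows "entry_time n x = 0 \<longleftrightarrow> x \<in> roof C B n"
proof
  assume "entry_time n x = 0"
  thus "x \<in> roof C B n"
    using funpow_entry_time[OF assms, of n] base_subset_roof[OF tower_of_in[OF assms]] by auto
qed (use entry_time_le[of 0 x n] in simp)

lemma entry_time_mono: "x \<in> X \<Longrightarrow> m \<le> n \<Longrightarrow> entry_time m x \<le> entry_time n x"
  using funpow_entry_time[of x n] base_subset_roof[OF tower_of_in, of x n] roof_antimono[of m n]
  by (intro entry_time_le) blast

lemma
  assumes x: "x \<in> X" and j: "j \<le> entry_time n x"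
  shows entry_time_funpow: "entry_time n ((T ^^ j) x) = entry_time n x - j"
    and tower_of_funpow: "tower_of n ((T ^^ j) x) = tower_of n x"
proof -
  have mem: "(T ^^ j) x \<in> atom n (tower_of n x) (entry_time n x - j)"
    using mem_preim_add[OF x, of "entry_time n x - j" j] mem_cell[OF x, of n] j by simp
  have less: "entry_time n x - j < h n (tower_of n x)" using entry_time_less[OF x, of n] by simp
  show "entry_time n ((T ^^ j) x) = entry_time n x - j"
    by (rule entry_time_eq[OF tower_of_in[OF x] less mem])
  show "tower_of n ((T ^^ j) x) = tower_of n x"
    by (rule tower_of_eq[OF tower_of_in[OF x] less mem])
qed

lemma Suc_entry_time_T_roof:
  assumes "x \<in> roof C B n" shows "Suc (entry_time n (T x)) = h n (tower_of n (T x))"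
proof (rule ccontr)
  have x: "x \<in> X" using assms roof_subset by blast
  let ?j = "entry_time n (T x)" and ?k = "tower_of n (T x)"
  assume "Suc ?j \<noteq> h n ?k"
  hence "Suc ?j < h n ?k" using entry_time_less[OF T_in[OF x], of n] by simp
  moreover have "x \<in> atom n ?k (Suc ?j)"
    using mem_preim_add[OF x, of ?j 1] mem_cell[OF T_in[OF x], of n] by simp
  ultimately have "entry_time n x = Suc ?j"
    using tower_of_in[OF T_in[OF x]] by (intro entry_time_eq)
  thus False using entry_time_eq_0_iff[OF x, of n] assms by simp
qed

lemma atom_height_subset_roof:
  assumes k: "k \<in> towers n" shows "atom n k (h n k) \<subseteq> roof C B n"
proof
  fix x assume x: "x \<in> atom n k (h n k)"
  hence x_in: "x \<in> X" by (simp add: preim_def)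
  have "T x \<in> atom n k (h n k - 1)"
    using mem_preim_add[OF x_in, of "h n k - 1" 1] height_pos[OF k] x by simp
  moreover have "h n k - 1 < h n k" using height_pos[OF k] by simp
  ultimately have T_address: "entry_time n (T x) = h n k - 1" "tower_of n (T x) = k"
    using entry_time_eq[OF k] tower_of_eq[OF k] by blast+
  have "entry_time n x = 0"
  proof (rule ccontr)
    assume "entry_time n x \<noteq> 0"
    hence "entry_time n x = h n (tower_of n x)"
      using entry_time_funpow[OF x_in, of 1 n] tower_of_funpow[OF x_in, of 1 n] T_address
        height_pos[OF k] by simp
    thus False using entry_time_less[OF x_in, of n] by simp
  qed
  thus "x \<in> roof C B n" using entry_time_eq_0_iff[OF x_in] by simp
qed

lemma single_tower_periodic:
  assumes "towers n = {1}" shows "atom n 1 (h n 1) = B n 1"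
proof
  show "atom n 1 (h n 1) \<subseteq> B n 1"
    using atom_height_subset_roof[of 1 n] assms by (auto elim!: roofE)
  show "B n 1 \<subseteq> atom n 1 (h n 1)"
  proof
    fix x assume x: "x \<in> B n 1"
    hence "x \<in> X" "x \<in> roof C B n" using base_subset base_subset_roof one_in_towers by blast+
    moreover have "tower_of n (T x) = 1" using tower_of_in[OF T_in[OF \<open>x \<in> X\<close>], of n] assms by simp
    ultimately show "x \<in> atom n 1 (h n 1)"
      using mem_preim_add[of x "entry_time n (T x)" 1] mem_cell[OF T_in, of x n]
        Suc_entry_time_T_roof[of x n] by simp
  qed
qed

subsection \<open>Visits of a tower to the bases of the previous level\<close>

definition visits :: "nat \<Rightarrow> nat \<Rightarrow> nat \<Rightarrow> nat set" where
  "visits n l k = {i. i < h (Suc n) l \<and> atom (Suc n) l i \<subseteq> B n k}"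

lemma finite_visits [simp]: "finite (visits n l k)"
  by (rule finite_subset[of _ "{..<h (Suc n) l}"]) (auto simp: visits_def)

lemma
  assumes "i \<in> visits n l k"
  shows visit_less: "i < h (Suc n) l" and visit_subset_base: "atom (Suc n) l i \<subseteq> B n k"
  using assms by (auto simp: visits_def)

lemma visits_nonempty:
  assumes "k \<in> towers n" "l \<in> towers (Suc n)" shows "visits n l k \<noteq> {}"
proof -
  have "\<forall>n\<ge>1. \<forall>k\<in>{1..C (n - 1)}. \<forall>l\<in>{1..C n}. \<exists>j<h n l. preim X T j (B n l) \<subseteq> B (n - 1) k"
    using KR_sequence by (simp add: KR_sequence_def)
  from this[rule_format, of "Suc n" k l] assms show ?thesis by (auto simp: visits_def towers_def)
qed

lemma one_le_card_visits: "k \<in> towers n \<Longrightarrow> l \<in> towers (Suc n) \<Longrightarrow> 1 \<le> card (visits n l k)"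
  using visits_nonempty by (simp add: Suc_le_eq card_gt_0_iff)

lemma visitI:
  assumes "l \<in> towers (Suc n)" "i < h (Suc n) l" "k \<in> towers n" "x \<in> atom (Suc n) l i" "x \<in> B n k"
  shows "i \<in> visits n l k"
proof -
  obtain k' j where address: "k' \<in> towers n" "j < h n k'" "atom (Suc n) l i \<subseteq> atom n k' j"
    using atom_refine[OF assms(1,2)] .
  have "k' = k \<and> j = 0"
    using atom_unique[OF address(1,2) assms(3) height_pos[OF assms(3)], of x] assms(4,5) address(3)
      atom_0[OF assms(3)] by auto
  thus ?thesis using address assms atom_0[OF assms(3)] by (auto simp: visits_def)
qed

lemma zero_visit: "l \<in> towers (Suc n) \<Longrightarrow> 0 \<in> visits n l 1"
  using roof_Suc_subset_base[of n] height_pos[of l "Suc n"] atom_0[of l "Suc n"]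
    base_subset_roof[of l "Suc n"] by (auto simp: visits_def)

lemma atom_visit_add_subset:
  assumes "i \<in> visits n l k" shows "atom (Suc n) l (i + j) \<subseteq> atom n k j"
proof
  fix x assume x: "x \<in> atom (Suc n) l (i + j)"
  hence "x \<in> X" by (simp add: preim_def)
  with x show "x \<in> atom n k j"
    using mem_preim_add[of x i j] visit_subset_base[OF assms] by (auto simp: preim_def)
qed

lemma visit_add_height_le:
  assumes l: "l \<in> towers (Suc n)" and k: "k \<in> towers n" and i: "i \<in> visits n l k"
    and "i < m" "atom (Suc n) l m \<subseteq> roof C B n"
  shows "i + h n k \<le> m"
proof (rule ccontr)
  assume "\<not> ?thesis"
  hence offset: "m = i + (m - i)" "m - i < h n k" "m - i \<noteq> 0" using \<open>i < m\<close> by auto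
  obtain x where x: "x \<in> atom (Suc n) l m" using atom_nonempty[OF l] by blast
  hence "x \<in> atom n k (m - i)" using atom_visit_add_subset[OF i, of "m - i"] offset(1) by auto
  hence "entry_time n x = m - i" using entry_time_eq[OF k offset(2)] by blast
  moreover have "entry_time n x = 0" using x assms(5) roof_subset entry_time_eq_0_iff by blast
  ultimately show False using offset(3) by simp
qed

lemma visit_add_height_le_height:
  assumes l: "l \<in> towers (Suc n)" and k: "k \<in> towers n" and i: "i \<in> visits n l k"
  shows "i + h n k \<le> h (Suc n) l"
  by (rule visit_add_height_le[OF l k i visit_less[OF i]
        order_trans[OF atom_height_subset_roof[OF l] roof_Suc_subset]])

lemma height_le_height_Suc: "l \<in> towers (Suc n) \<Longrightarrow> h n 1 \<le> h (Suc n) l"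
  using visit_add_height_le_height[OF _ one_in_towers zero_visit] by simp

definition entry_increment :: "nat \<Rightarrow> 'a \<Rightarrow> nat" where
  "entry_increment n x = entry_time (Suc n) x - entry_time n x"

lemma entry_time_Suc: "x \<in> X \<Longrightarrow> entry_time (Suc n) x = entry_increment n x + entry_time n x"
  using entry_time_mono[of x n "Suc n"] by (simp add: entry_increment_def)

lemma entry_increment_visit:
  assumes x: "x \<in> X" shows "entry_increment n x \<in> visits n (tower_of (Suc n) x) (tower_of n x)"
proof (rule visitI)
  show "(T ^^ entry_time n x) x \<in> atom (Suc n) (tower_of (Suc n) x) (entry_increment n x)"
    using mem_cell[OF x, of "Suc n"] by (simp add: entry_time_Suc[OF x] mem_preim_add[OF x])
  show "entry_increment n x < h (Suc n) (tower_of (Suc n) x)"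
    using entry_time_less[OF x, of "Suc n"] by (simp add: entry_increment_def)
qed (simp_all add: x tower_of_in funpow_entry_time)

lemma bij_betw_visits_tower:
  assumes l: "l \<in> towers (Suc n)"
  shows "bij_betw (\<lambda>(k, i, j). i + j) (SIGMA k:towers n. visits n l k \<times> {..<h n k})
    {..<h (Suc n) l}" (is "bij_betw ?f ?D _")
proof (rule bij_betw_imageI)
  show "inj_on ?f ?D"
  proof (rule inj_onI, clarsimp)
    fix k i j k' i' j'
    assume left: "k \<in> towers n" "i \<in> visits n l k" "j < h n k"
      and right: "k' \<in> towers n" "i' \<in> visits n l k'" "j' < h n k'" and eq: "i + j = i' + j'"
    obtain x where "x \<in> atom (Suc n) l (i + j)" using atom_nonempty[OF l] by blast
    hence "x \<in> atom n k j" "x \<in> atom n k' j'"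
      using atom_visit_add_subset[OF left(2), of j] atom_visit_add_subset[OF right(2), of j'] eq
      by auto
    with left right have "k = k' \<and> j = j'" by (intro atom_unique)
    thus "k = k' \<and> i = i' \<and> j = j'" using eq by simp
  qed
  show "?f ` ?D = {..<h (Suc n) l}"
  proof (intro equalityI subsetI)
    fix m assume m: "m \<in> {..<h (Suc n) l}"
    obtain x where x: "x \<in> atom (Suc n) l m" using atom_nonempty[OF l] by blast
    hence x_in: "x \<in> X" by (simp add: preim_def)
    have "entry_time (Suc n) x = m" "tower_of (Suc n) x = l"
      using m x by (simp_all add: entry_time_eq[OF l] tower_of_eq[OF l])
    hence "m = ?f (tower_of n x, entry_increment n x, entry_time n x)"
        "(tower_of n x, entry_increment n x, entry_time n x) \<in> ?D"
      using entry_time_Suc[OF x_in] entry_increment_visit[OF x_in] tower_of_in[OF x_in]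
        entry_time_less[OF x_in] by auto
    thus "m \<in> ?f ` ?D" by blast
  qed (use visit_add_height_le_height[OF l] in fastforce)
qed

lemma sum_tower_eq_sum_visits:
  fixes F :: "nat \<Rightarrow> 'b::comm_monoid_add"
  assumes l: "l \<in> towers (Suc n)"
  shows "(\<Sum>j<h (Suc n) l. F j) = (\<Sum>k\<in>towers n. \<Sum>i\<in>visits n l k. \<Sum>j<h n k. F (i + j))"
proof -
  have "(\<Sum>j<h (Suc n) l. F j)
      = (\<Sum>(k, i, j)\<in>(SIGMA k:towers n. visits n l k \<times> {..<h n k}). F (i + j))"
    by (subst sum.reindex_bij_betw[OF bij_betw_visits_tower[OF l], symmetric])
      (simp add: case_prod_unfold)
  also have "\<dots> = (\<Sum>k\<in>towers n. \<Sum>(i, j)\<in>visits n l k \<times> {..<h n k}. F (i + j))"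
    by (subst sum.Sigma) auto
  also have "\<dots> = (\<Sum>k\<in>towers n. \<Sum>i\<in>visits n l k. \<Sum>j<h n k. F (i + j))"
    by (simp add: sum.cartesian_product)
  finally show ?thesis .
qed

lemma height_Suc:
  assumes "l \<in> towers (Suc n)"
  shows "h (Suc n) l = (\<Sum>k\<in>towers n. card (visits n l k) * h n k)"
  using sum_tower_eq_sum_visits[OF assms, of "\<lambda>_. 1::nat"] by simp

lemma towers_eq_1_if_height_le:
  assumes l: "l \<in> towers (Suc n)" and le: "h (Suc n) l \<le> h n 1"
  shows "towers n = {1}"
proof (rule ccontr)
  assume "towers n \<noteq> {1}"
  then obtain k where k: "k \<in> towers n" "k \<noteq> 1" using one_in_towers by blast
  have "h n 1 + h n k \<le> (\<Sum>k\<in>{1, k}. card (visits n l k) * h n k)"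
    using k one_le_card_visits[OF _ l] by (simp add: add_mono)
  also have "\<dots> \<le> h (Suc n) l"
    unfolding height_Suc[OF l] using k by (intro sum_mono2) auto
  finally show False using le height_pos[OF k(1)] by simp
qed

lemma visit_eq_sum_earlier_visits:
  assumes l: "l \<in> towers (Suc n)" and k: "k \<in> towers n" and i: "i \<in> visits n l k"
  shows "i = (\<Sum>k'\<in>towers n. card {i' \<in> visits n l k'. i' < i} * h n k')"
proof -
  have "i = (\<Sum>j<h (Suc n) l. of_bool (j < i))"
    using visit_less[OF i] by (simp add: sum_of_bool_eq Int_absorb1 subset_eq flip: lessThan_def)
  also have "\<dots> = (\<Sum>k'\<in>towers n. \<Sum>i'\<in>visits n l k'. \<Sum>j<h n k'. of_bool (i' + j < i))"
    by (rule sum_tower_eq_sum_visits[OF l])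
  also have "\<dots> = (\<Sum>k'\<in>towers n. \<Sum>i'\<in>visits n l k'. of_bool (i' < i) * h n k')"
  proof (intro sum.cong refl)
    fix k' i' assume k': "k' \<in> towers n" and i': "i' \<in> visits n l k'"
    have "atom (Suc n) l i \<subseteq> roof C B n"
      using visit_subset_base[OF i] base_subset_roof[OF k] by blast
    hence "of_bool (i' + j < i) = (of_bool (i' < i) :: nat)" if "j < h n k'" for j
      using visit_add_height_le[OF l k' i', of i] that by auto
    thus "(\<Sum>j<h n k'. of_bool (i' + j < i)) = of_bool (i' < i) * h n k'" by simp
  qed
  also have "\<dots> = (\<Sum>k'\<in>towers n. card {i' \<in> visits n l k'. i' < i} * h n k')"
    by (simp add: sum_of_bool_eq Int_def flip: sum_distrib_right)
  finally show ?thesis .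
qed

lemma PH1_eq_height: "l \<in> towers (Suc n) \<Longrightarrow> PH1 X T C B h (Suc n) l = real (h (Suc n) l)"
proof (induction n arbitrary: l)
  case 0
  have "(\<Sum>k=1..C 1. (if l = k then 1 else 0) * real (h (Suc 0) k))
      = (\<Sum>k=1..C 1. if k = l then real (h (Suc 0) k) else 0)"
    by (intro sum.cong) auto
  thus ?case using 0 by (simp add: PH1_def towers_def)
next
  case (Suc n)
  let ?M = "Mmat X T B h (Suc (Suc n))" and ?P = "\<lambda>n. Pmat X T C B h n 1"
  have P: "?P (Suc (Suc n)) l k = (\<Sum>r\<in>towers (Suc n). ?M l r * ?P (Suc n) r k)" for k
    by (subst Pmat.simps(2)) (simp add: matmul_def towers_def del: Pmat.simps)
  have "PH1 X T C B h (Suc (Suc n)) l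
      = (\<Sum>k=1..C 1. \<Sum>r\<in>towers (Suc n). ?M l r * (?P (Suc n) r k * real (h 1 k)))"
    unfolding PH1_def P by (simp add: sum_distrib_right mult.assoc del: Pmat.simps)
  also have "\<dots> = (\<Sum>r\<in>towers (Suc n). ?M l r * PH1 X T C B h (Suc n) r)"
    by (subst sum.swap) (simp add: PH1_def sum_distrib_left del: Pmat.simps)
  also have "\<dots> = (\<Sum>r\<in>towers (Suc n). real (card (visits (Suc n) l r)) * real (h (Suc n) r))"
    using Suc.IH by (intro sum.cong) (auto simp: Mmat_def visits_def)
  finally show ?case using height_Suc[OF Suc.prems] by simp
qed

subsection \<open>The topology generated by the towers\<close>

abbreviation "cell n x \<equiv> atom n (tower_of n x) (entry_time n x)"

lemma cell_in_atoms: "x \<in> X \<Longrightarrow> cell n x \<in> atoms X T C B h n"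
  unfolding atoms_eq using tower_of_in entry_time_less by blast

lemma atoms_cell: "A \<in> atoms X T C B h n \<Longrightarrow> x \<in> A \<Longrightarrow> x \<in> X \<and> A = cell n x"
  unfolding atoms_eq using entry_time_eq tower_of_eq preim_subset by fastforce

lemma cell_antimono:
  assumes "x \<in> X" "m \<le> n" shows "cell n x \<subseteq> cell m x"
  using assms(2)
proof (rule lift_Suc_antimono_le[of "\<lambda>n. cell n x", rotated])
  show "cell (Suc n) x \<subseteq> cell n x" for n
    using atom_visit_add_subset[OF entry_increment_visit[OF assms(1)]]
    by (simp add: entry_time_Suc assms(1))
qed

lemma entry_time_cell:
  assumes x: "x \<in> X" and y: "y \<in> cell n x" and "m \<le> n"
  shows "entry_time m y = entry_time m x"
  using cell_antimono[OF x \<open>m \<le> n\<close>] y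
  by (intro entry_time_eq[OF tower_of_in[OF x] entry_time_less[OF x]]) blast

lemma cell_basis:
  assumes "openin (top_of_set X) U" "x \<in> U"
  obtains n where "cell n x \<subseteq> U"
proof -
  have "top_of_set X = topology_generated_by (\<Union>n. atoms X T C B h n)"
    using KR_sequence by (simp add: KR_sequence_def)
  hence "generate_topology_on (\<Union>n. atoms X T C B h n) U"
    using assms(1) openin_topology_generated_by by metis
  moreover have x_in: "x \<in> X" using assms openin_imp_subset by blast
  ultimately have "\<exists>n. cell n x \<subseteq> U" using assms(2)
  proof (induction)
    case (Int a b)
    then obtain n m where "cell n x \<subseteq> a" "cell m x \<subseteq> b" by blast
    hence "cell (max n m) x \<subseteq> a \<inter> b"
      using cell_antimono[OF x_in, of n "max n m"] cell_antimono[OF x_in, of m "max n m"] by auto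
    thus ?case by blast
  next
    case (Basis s)
    then obtain n where "s \<in> atoms X T C B h n" by blast
    thus ?case using atoms_cell[of s n x] Basis.prems by blast
  qed blast+
  thus ?thesis using that by blast
qed

lemma openin_atom: "k \<in> towers n \<Longrightarrow> openin (top_of_set X) (atom n k j)"
  by (intro openin_preim openin_base)

lemma continuous_on_entry_time:
  fixes g :: "nat \<Rightarrow> 'b::topological_space"
  shows "continuous_on X (\<lambda>x. g (entry_time n x))"
  unfolding continuous_on_def
proof
  fix x assume x: "x \<in> X"
  obtain U where U: "open U" "cell n x = X \<inter> U"
    using openin_atom[OF tower_of_in[OF x, of n]] unfolding openin_open by blast
  have "\<forall>\<^sub>F y in at x within X. g (entry_time n y) = g (entry_time n x)"
    unfolding eventually_at_topological
  proof (intro exI[of _ U] conjI ballI impI)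
    fix y assume "y \<in> U" "y \<in> X"
    hence "y \<in> cell n x" using U by blast
    thus "g (entry_time n y) = g (entry_time n x)" using entry_time_cell[OF x, of y n n] by simp
  qed (use U mem_cell[OF x, of n] in auto)
  thus "((\<lambda>x. g (entry_time n x)) \<longlongrightarrow> g (entry_time n x)) (at x within X)"
    by (rule tendsto_eventually)
qed

definition base_point :: 'a where
  "base_point = (THE x. (\<Inter>n. roof C B n) = {x})"

lemma Inter_roof: "(\<Inter>n. roof C B n) = {base_point}"
proof -
  have "\<exists>x. (\<Inter>n. roof C B n) = {x}" using KR_sequence by (simp add: KR_sequence_def)
  then obtain x where x: "(\<Inter>n. roof C B n) = {x}" ..
  hence "base_point = x" unfolding base_point_def by (intro the_equality) auto
  thus ?thesis using x by simp
qed

lemma base_point_roof: "base_point \<in> roof C B n"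
  using Inter_roof by auto

lemma base_point_in: "base_point \<in> X"
  using base_point_roof roof_subset by blast

lemma roof_basis_base_point:
  assumes "openin (top_of_set X) U" "base_point \<in> U"
  obtains n where "roof C B n \<subseteq> U"
proof -
  obtain n where n: "cell n base_point \<subseteq> U" using cell_basis[OF assms] .
  have "base_point \<in> atom n 1 0" using roof_Suc_subset_base base_point_roof atom_0 by auto
  hence "cell n base_point = B n 1"
    using entry_time_eq tower_of_eq height_pos atom_0 one_in_towers by metis
  thus ?thesis using that n roof_Suc_subset_base[of n] by blast
qed

lemma eventually_entry_time_pos:
  assumes "x \<in> X" "x \<noteq> base_point"
  shows "\<forall>\<^sub>F n in sequentially. 0 < entry_time n x"
proof -
  obtain N where N: "x \<notin> roof C B N" using Inter_roof assms(2) by blast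
  have "0 < entry_time n x" if "N \<le> n" for n
    using entry_time_eq_0_iff[OF assms(1), of n] roof_antimono[OF that] N by blast
  thus ?thesis unfolding eventually_sequentially by blast
qed

end

section \<open>Invariant measures\<close>

locale invariant_measure =
  fixes X :: "'a::metric_space set" and T :: "'a \<Rightarrow> 'a" and \<mu> :: "'a measure"
  assumes invariant: "invariant_prob X T \<mu>"
begin

sublocale prob_space \<mu>
  using invariant by (simp add: invariant_prob_def)

lemma sets_mu: "sets \<mu> = sets (restrict_space borel X)"
  using invariant by (simp add: invariant_prob_def)

lemma space_mu [simp]: "space \<mu> = X"
  using sets_eq_imp_space_eq[OF sets_mu] by (simp add: space_restrict_space)

lemma prob_X [simp]: "prob X = 1"
  using prob_space by simp

lemma T_measurable [measurable]: "T \<in> measurable \<mu> \<mu>"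
  using invariant by (simp add: invariant_prob_def)

lemma openin_sets:
  assumes "openin (top_of_set X) U" shows "U \<in> sets \<mu>"
proof -
  obtain S where S: "open S" "U = X \<inter> S" using assms unfolding openin_open by blast
  have "X \<inter> S \<in> (\<inter>) X ` sets borel" by (intro imageI borel_open S(1))
  thus ?thesis by (simp only: sets_mu sets_restrict_space S(2))
qed

lemma singleton_sets: "x \<in> X \<Longrightarrow> {x} \<in> sets \<mu>"
  by (auto simp: sets_mu sets_restrict_space intro!: image_eqI[of _ _ "{x}"])

lemma continuous_on_measurable:
  fixes f :: "'a \<Rightarrow> 'b::topological_space"
  assumes "continuous_on X f" shows "f \<in> borel_measurable \<mu>"
  using borel_measurable_continuous_on_restrict[OF assms] measurable_cong_sets[OF sets_mu refl]
  by blast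

lemma integrable_if_bounded:
  fixes g :: "'a \<Rightarrow> real"
  assumes "g \<in> borel_measurable \<mu>" "\<And>x. x \<in> X \<Longrightarrow> \<bar>g x\<bar> \<le> c" shows "integrable \<mu> g"
  using assms by (intro integrable_const_bound[of _ c]) (auto intro!: AE_I2)

lemma abs_set_integral_le:
  fixes g :: "'a \<Rightarrow> real"
  assumes g: "g \<in> borel_measurable \<mu>" "\<And>x. x \<in> X \<Longrightarrow> \<bar>g x\<bar> \<le> c" and A: "A \<in> sets \<mu>"
  shows "\<bar>LINT x:A|\<mu>. g x\<bar> \<le> c * measure \<mu> A"
proof -
  have integrable: "set_integrable \<mu> A g"
    by (intro integrable_imp_set_integrable integrable_if_bounded[OF g] A)
  have "A \<subseteq> X" using sets.sets_into_space[OF A] by simp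
  have "\<bar>LINT x:A|\<mu>. g x\<bar> \<le> (LINT x:A|\<mu>. \<bar>g x\<bar>)"
    using integral_abs_bound[of \<mu> "\<lambda>x. indicator A x *\<^sub>R g x"]
    by (simp add: set_lebesgue_integral_def abs_mult)
  also have "\<dots> \<le> (LINT x:A|\<mu>. c)"
    using g(2) \<open>A \<subseteq> X\<close>
    by (intro set_integral_mono set_integrable_abs integrable integrable_imp_set_integrable A) auto
  also have "\<dots> = c * measure \<mu> A" using A by (simp add: set_integral_const emeasure_eq_measure)
  finally show ?thesis .
qed

lemma preim_eq_vimage: "preim X T j A = (T ^^ j) -` A \<inter> space \<mu>"
  by (auto simp: preim_def)

lemma preim_sets [measurable]: "A \<in> sets \<mu> \<Longrightarrow> preim X T j A \<in> sets \<mu>"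
  unfolding preim_eq_vimage by measurable

lemma distr_funpow: "distr \<mu> \<mu> (T ^^ j) = \<mu>"
proof (induction j)
  case 0
  thus ?case by (simp add: id_def distr_id2)
next
  case (Suc j)
  have "distr \<mu> \<mu> T = \<mu>"
    using invariant by (intro measure_eqI) (auto simp: emeasure_distr invariant_prob_def)
  moreover have "distr \<mu> \<mu> (T ^^ Suc j) = distr (distr \<mu> \<mu> (T ^^ j)) \<mu> T"
    by (subst distr_distr) (simp_all add: comp_def)
  ultimately show ?case by (simp only: Suc)
qed

lemma measure_preim: "A \<in> sets \<mu> \<Longrightarrow> measure \<mu> (preim X T j A) = measure \<mu> A"
  using measure_distr[of "T ^^ j" \<mu> \<mu> A] by (simp add: distr_funpow preim_eq_vimage)

lemma AE_funpow: "AE x in \<mu>. P x \<Longrightarrow> AE x in \<mu>. P ((T ^^ j) x)"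
  by (rule AE_distrD[of _ \<mu> \<mu>]) (measurable, simp only: distr_funpow)

lemma set_integral_funpow:
  fixes g :: "'a \<Rightarrow> 'b::{banach, second_countable_topology}"
  assumes [measurable]: "g \<in> borel_measurable \<mu>" "A \<in> sets \<mu>"
  shows "(LINT x:preim X T j A|\<mu>. g ((T ^^ j) x)) = (LINT x:A|\<mu>. g x)"
proof -
  have "(LINT x:A|\<mu>. g x) = (LINT x|distr \<mu> \<mu> (T ^^ j). indicator A x *\<^sub>R g x)"
    by (simp add: distr_funpow set_lebesgue_integral_def)
  also have "\<dots> = (LINT x|\<mu>. indicator A ((T ^^ j) x) *\<^sub>R g ((T ^^ j) x))"
    by (rule integral_distr) measurable
  also have "\<dots> = (LINT x:preim X T j A|\<mu>. g ((T ^^ j) x))"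
    unfolding set_lebesgue_integral_def
    by (intro Bochner_Integration.integral_cong) (auto simp: indicator_def preim_def)
  finally show ?thesis by simp
qed

lemma set_integral_preim_eigen:
  fixes g :: "'a \<Rightarrow> 'b::{real_normed_field, banach, second_countable_topology}"
  assumes [measurable]: "g \<in> borel_measurable \<mu>" "A \<in> sets \<mu>"
    and eigen: "AE x in \<mu>. g ((T ^^ j) x) = c * g x"
  shows "c * (LINT x:preim X T j A|\<mu>. g x) = (LINT x:A|\<mu>. g x)"
proof -
  have "(LINT x:A|\<mu>. g x) = (LINT x:preim X T j A|\<mu>. g ((T ^^ j) x))"
    by (simp add: set_integral_funpow)
  also have "\<dots> = (LINT x:preim X T j A|\<mu>. c * g x)"
    using eigen by (intro set_lebesgue_integral_cong_AE) auto
  finally show ?thesis by simp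
qed

lemma AE_eigen_funpow:
  assumes "AE x in \<mu>. f (T x) = unit_char \<alpha> * f x"
  shows "AE x in \<mu>. f ((T ^^ j) x) = unit_char (\<alpha> * real j) * f x"
proof (induction j)
  case (Suc j)
  from AE_funpow[OF assms, of j] Suc show ?case
    by eventually_elim (simp add: ring_distribs unit_char_add)
qed simp

lemma AE_neq_aperiodic_point:
  assumes x: "x \<in> X" and aperiodic: "\<And>p. 0 < p \<Longrightarrow> (T ^^ p) x \<noteq> x"
  shows "AE y in \<mu>. y \<noteq> x"
proof -
  have "i = j" if "y \<in> preim X T i {x}" "y \<in> preim X T j {x}" "i \<le> j" for i j y
  proof (rule ccontr)
    assume "i \<noteq> j"
    have "(T ^^ ((j - i) + i)) y = (T ^^ (j - i)) x"
      using that by (subst funpow_add) (simp add: preim_def)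
    hence "(T ^^ (j - i)) x = x" using that by (simp add: preim_def)
    thus False using aperiodic[of "j - i"] \<open>i \<le> j\<close> \<open>i \<noteq> j\<close> by simp
  qed
  hence "disjoint_family (\<lambda>j. preim X T j {x})"
    unfolding disjoint_family_on_def by (metis disjoint_iff nat_le_linear)
  hence "summable (\<lambda>j. measure \<mu> (preim X T j {x}))"
    using singleton_sets[OF x] preim_sets by (intro sums_summable[OF finite_measure_UNION]) auto
  hence "measure \<mu> {x} = 0"
    using singleton_sets[OF x] by (simp add: measure_preim summable_const_iff)
  hence "{x} \<in> null_sets \<mu>"
    using singleton_sets[OF x] by (simp add: null_sets_def emeasure_eq_measure)
  from AE_not_in[OF this] show ?thesis by simp
qed

lemma
  fixes f :: "'a \<Rightarrow> complex"
  assumes [measurable]: "f \<in> borel_measurable \<mu>" and unimodular: "AE x in \<mu>. norm (f x) = 1"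
  shows unimodular_square_integrable: "integrable \<mu> (\<lambda>x. (norm (f x))\<^sup>2)"
    and unimodular_not_AE_zero: "\<not> (AE x in \<mu>. f x = 0)"
proof -
  have "AE x in \<mu>. norm ((norm (f x))\<^sup>2) \<le> 1" using unimodular by eventually_elim simp
  thus "integrable \<mu> (\<lambda>x. (norm (f x))\<^sup>2)" by (intro integrable_const_bound) auto
  show "\<not> (AE x in \<mu>. f x = 0)"
  proof
    assume "AE x in \<mu>. f x = 0"
    with unimodular have "AE x in \<mu>. False" by eventually_elim simp
    thus False by simp
  qed
qed

end

section \<open>Integration over towers\<close>

locale kakutani_rohlin_measure = kakutani_rohlin X T Ti C B h + invariant_measure X T \<mu>
  for X :: "'a::metric_space set" and T Ti :: "'a \<Rightarrow> 'a"
    and C :: "nat \<Rightarrow> nat" and B :: "nat \<Rightarrow> nat \<Rightarrow> 'a set" and h :: "nat \<Rightarrow> nat \<Rightarrow> nat"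
    and \<mu> :: "'a measure"
begin

abbreviation "base_measure n k \<equiv> measure \<mu> (B n k)"

lemma base_sets [measurable]: "k \<in> towers n \<Longrightarrow> B n k \<in> sets \<mu>"
  by (intro openin_sets openin_base)

lemma atom_sets [measurable]: "k \<in> towers n \<Longrightarrow> atom n k j \<in> sets \<mu>"
  by (intro openin_sets openin_atom)

lemma measure_atom: "k \<in> towers n \<Longrightarrow> measure \<mu> (atom n k j) = base_measure n k"
  by (simp add: measure_preim)

lemma entry_time_measurable [measurable]: "entry_time n \<in> measurable \<mu> (count_space UNIV)"
  using continuous_on_measurable[OF continuous_on_entry_time[of "\<lambda>j. j" n]]
    measurable_cong_sets[OF refl sets_borel_eq_count_space] by blast

lemma disjoint_atoms: "disjoint_family_on (\<lambda>(k, j). atom n k j) (SIGMA k:towers n. {..<h n k})"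
  unfolding disjoint_family_on_def using atom_unique by fastforce

lemma set_integral_Union_atoms:
  fixes g :: "'a \<Rightarrow> 'b::{banach, second_countable_topology}"
  assumes g: "integrable \<mu> g" and J: "\<And>k. k \<in> towers n \<Longrightarrow> J k \<subseteq> {..<h n k}"
  shows "(LINT x:(\<Union>k\<in>towers n. \<Union>j\<in>J k. atom n k j)|\<mu>. g x)
    = (\<Sum>k\<in>towers n. \<Sum>j\<in>J k. LINT x:atom n k j|\<mu>. g x)"
proof -
  let ?I = "SIGMA k:towers n. J k"
  have finite_J: "finite (J k)" if "k \<in> towers n" for k using J[OF that] finite_subset by blast
  have "(\<Union>k\<in>towers n. \<Union>j\<in>J k. atom n k j) = (\<Union>t\<in>?I. case t of (k, j) \<Rightarrow> atom n k j)" by auto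
  hence "(LINT x:(\<Union>k\<in>towers n. \<Union>j\<in>J k. atom n k j)|\<mu>. g x)
      = (LINT x:(\<Union>t\<in>?I. case t of (k, j) \<Rightarrow> atom n k j)|\<mu>. g x)" by simp
  also have "\<dots> = (\<Sum>t\<in>?I. LINT x:(case t of (k, j) \<Rightarrow> atom n k j)|\<mu>. g x)"
    using finite_J J
    by (intro set_integral_finite_Union disjoint_family_on_mono[OF _ disjoint_atoms[of n]]
        finite_SigmaI) (auto intro!: integrable_imp_set_integrable g)
  also have "\<dots> = (\<Sum>(k, j)\<in>?I. LINT x:atom n k j|\<mu>. g x)"
    by (intro sum.cong) auto
  also have "\<dots> = (\<Sum>k\<in>towers n. \<Sum>j\<in>J k. LINT x:atom n k j|\<mu>. g x)"
    using finite_J by (intro sum.Sigma[symmetric]) auto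
  finally show ?thesis .
qed

lemma integral_eq_sum_atoms:
  fixes g :: "'a \<Rightarrow> 'b::{banach, second_countable_topology}"
  assumes "integrable \<mu> g"
  shows "(LINT x|\<mu>. g x) = (\<Sum>k\<in>towers n. \<Sum>j<h n k. LINT x:atom n k j|\<mu>. g x)"
  using set_integral_Union_atoms[OF assms, of n "\<lambda>k. {..<h n k}"] set_integral_space[OF assms]
  by (simp add: Union_atoms)

lemma base_eq_Union_visits:
  assumes "k \<in> towers n"
  shows "B n k = (\<Union>l\<in>towers (Suc n). \<Union>i\<in>visits n l k. atom (Suc n) l i)"
proof (intro equalityI subsetI)
  fix x assume x: "x \<in> B n k"
  hence x_in: "x \<in> X" using base_subset[OF assms] by blast
  have "entry_time (Suc n) x \<in> visits n (tower_of (Suc n) x) k"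
    using visitI[OF tower_of_in[OF x_in] entry_time_less[OF x_in] assms mem_cell[OF x_in] x] .
  thus "x \<in> (\<Union>l\<in>towers (Suc n). \<Union>i\<in>visits n l k. atom (Suc n) l i)"
    using tower_of_in[OF x_in] mem_cell[OF x_in] by blast
qed (use visit_subset_base in blast)

lemma set_integral_base_eq_sum_visits:
  fixes g :: "'a \<Rightarrow> 'b::{banach, second_countable_topology}"
  assumes "integrable \<mu> g" "k \<in> towers n"
  shows "(LINT x:B n k|\<mu>. g x)
    = (\<Sum>l\<in>towers (Suc n). \<Sum>i\<in>visits n l k. LINT x:atom (Suc n) l i|\<mu>. g x)"
  unfolding base_eq_Union_visits[OF assms(2)]
  using visit_less by (intro set_integral_Union_atoms assms(1)) blast

lemma set_integral_one: "A \<in> sets \<mu> \<Longrightarrow> (LINT x:A|\<mu>. 1) = measure \<mu> A"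
  using set_integral_const[of A \<mu> "1::real"] by (simp add: emeasure_eq_measure)

lemma sum_height_base_measure: "(\<Sum>k\<in>towers n. real (h n k) * base_measure n k) = 1"
  using integral_eq_sum_atoms[of "\<lambda>_. 1::real" n] by (simp add: set_integral_one measure_atom)

lemma base_measure_rec:
  "k \<in> towers n \<Longrightarrow>
     base_measure n k = (\<Sum>l\<in>towers (Suc n). real (card (visits n l k)) * base_measure (Suc n) l)"
  using set_integral_base_eq_sum_visits[of "\<lambda>_. 1::real" k n]
  by (simp add: set_integral_one measure_atom)

lemma base_measure_pos:
  assumes k: "k \<in> towers n" shows "0 < base_measure n k"
proof -
  obtain l where l: "l \<in> towers (Suc n)" "base_measure (Suc n) l \<noteq> 0"
    using sum_height_base_measure[of "Suc n"]
    by (cases "\<forall>l\<in>towers (Suc n). base_measure (Suc n) l = 0") auto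
  have "0 < real (card (visits n l k)) * base_measure (Suc n) l"
    using l one_le_card_visits[OF k l(1)] by (simp add: zero_less_measure_iff)
  also have "\<dots> \<le> (\<Sum>l\<in>towers (Suc n). real (card (visits n l k)) * base_measure (Suc n) l)"
    using l by (intro member_le_sum) auto
  finally show ?thesis unfolding base_measure_rec[OF k] .
qed

lemma AE_zero_imp_zero:
  fixes g :: "'a \<Rightarrow> 'b::real_normed_vector"
  assumes g: "continuous_on X g" and zero: "AE x in \<mu>. g x = 0" and x: "x \<in> X"
  shows "g x = 0"
proof (rule ccontr)
  assume "g x \<noteq> 0"
  have "openin (top_of_set X) (X \<inter> g -` (- {0}))"
    by (intro continuous_openin_preimage_gen g) auto
  then obtain n where n: "cell n x \<subseteq> X \<inter> g -` (- {0})"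
    by (rule cell_basis[of _ x]) (use x \<open>g x \<noteq> 0\<close> in auto)
  have "AE y in \<mu>. y \<notin> cell n x" using zero by eventually_elim (use n in auto)
  hence "cell n x \<in> null_sets \<mu>"
    using AE_iff_null_sets[OF atom_sets[OF tower_of_in[OF x]]] by blast
  hence "measure \<mu> (cell n x) = 0" by (rule measure_eq_0_null_sets)
  thus False
    using base_measure_pos[OF tower_of_in[OF x, of n]] measure_atom[OF tower_of_in[OF x, of n]]
    by simp
qed

lemma Int_stable_atoms: "Int_stable (insert {} (\<Union>n. atoms X T C B h n))"
proof (rule Int_stableI)
  let ?G = "insert {} (\<Union>n. atoms X T C B h n)"
  fix A A' assume A: "A \<in> ?G" "A' \<in> ?G"
  show "A \<inter> A' \<in> ?G"
  proof (cases "A \<inter> A' = {}")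
    case False
    then obtain x where x: "x \<in> A" "x \<in> A'" by blast
    then obtain n m where "x \<in> X" "A = cell n x" "A' = cell m x" using A atoms_cell by blast
    hence "A \<subseteq> A' \<or> A' \<subseteq> A" using cell_antimono[of x] nat_le_linear[of n m] by blast
    hence "A \<inter> A' = A \<or> A \<inter> A' = A'" by blast
    thus ?thesis using A by auto
  qed simp
qed

lemma openin_in_sigma_atoms:
  assumes U: "openin (top_of_set X) U"
  shows "U \<in> sigma_sets X (insert {} (\<Union>n. atoms X T C B h n))"
proof -
  let ?G = "insert {} (\<Union>n. atoms X T C B h n)"
  have "U = \<Union>{A \<in> ?G. A \<subseteq> U}"
  proof (intro equalityI subsetI)
    fix x assume x: "x \<in> U"
    hence x_in: "x \<in> X" using openin_imp_subset[OF U] by blast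
    obtain n where "cell n x \<subseteq> U" using cell_basis[OF U x] .
    thus "x \<in> \<Union>{A \<in> ?G. A \<subseteq> U}" using cell_in_atoms[OF x_in, of n] mem_cell[OF x_in, of n] by blast
  qed blast
  moreover have "?G \<subseteq> insert {} ((\<lambda>(n, k, j). atom n k j) ` UNIV)" by (auto simp: atoms_eq)
  hence "countable ?G" by (rule countable_subset) auto
  hence "countable {A \<in> ?G. A \<subseteq> U}" by (rule countable_subset[rotated]) auto
  hence "\<Union>{A \<in> ?G. A \<subseteq> U} \<in> sigma_sets X ?G" by (rule sigma_sets_UNION) auto
  ultimately show ?thesis by simp
qed

lemma sets_eq_sigma_atoms: "sets \<mu> = sigma_sets X (insert {} (\<Union>n. atoms X T C B h n))"
proof
  let ?G = "insert {} (\<Union>n. atoms X T C B h n)"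
  have "sets \<mu> = {(\<lambda>x. x) -` S \<inter> X | S. S \<in> sigma_sets UNIV {S. open S}}"
    unfolding sets_mu sets_restrict_space borel_def by auto
  also have "\<dots> = sigma_sets X {(\<lambda>x. x) -` S \<inter> X | S. S \<in> {S. open S}}"
    by (rule sigma_sets_vimage_commute) simp
  also have "\<dots> \<subseteq> sigma_sets X ?G"
  proof (intro sigma_sets_mono, clarify)
    fix S :: "'a set" assume "open S"
    hence "openin (top_of_set X) (X \<inter> S)" by (rule openin_open_Int)
    from openin_in_sigma_atoms[OF this] show "(\<lambda>x. x) -` S \<inter> X \<in> sigma_sets X ?G"
      by (simp add: Int_commute)
  qed
  finally show "sets \<mu> \<subseteq> sigma_sets X ?G" .
  have "?G \<subseteq> sets \<mu>" by (auto simp: atoms_eq)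
  thus "sigma_sets X ?G \<subseteq> sets \<mu>" using sets.sigma_sets_subset[of ?G \<mu>] by simp
qed

lemma AE_zero_if_atom_integrals_zero:
  fixes f :: "'a \<Rightarrow> 'b::{banach, second_countable_topology}"
  assumes f: "integrable \<mu> f"
    and zero: "\<And>n k j. k \<in> towers n \<Longrightarrow> j < h n k \<Longrightarrow> (LINT x:atom n k j|\<mu>. f x) = 0"
  shows "AE x in \<mu>. f x = 0"
proof (rule AE_zero_if_generator_integrals_zero[OF f Int_stable_atoms])
  show "insert {} (\<Union>n. atoms X T C B h n) \<subseteq> Pow (space \<mu>)"
    using preim_subset by (fastforce simp: atoms_eq)
  show "sets \<mu> = sigma_sets (space \<mu>) (insert {} (\<Union>n. atoms X T C B h n))"
    using sets_eq_sigma_atoms by simp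
  show "(LINT x|\<mu>. f x) = 0"
    using integral_eq_sum_atoms[OF f, of 0] zero by simp
  fix A assume A: "A \<in> insert {} (\<Union>n. atoms X T C B h n)"
  show "(LINT x:A|\<mu>. f x) = 0"
  proof (cases "A = {}")
    case True
    thus ?thesis by (simp add: set_lebesgue_integral_def)
  next
    case False
    thus ?thesis using A zero by (auto simp: atoms_eq)
  qed
qed

subsection \<open>Functions that are constant on the atoms of a level\<close>

definition level_constant :: "nat \<Rightarrow> ('a \<Rightarrow> 'b) \<Rightarrow> bool" where
  "level_constant m g \<longleftrightarrow> (\<forall>x\<in>X. \<forall>y\<in>cell m x. g y = g x)"

definition sample_point :: "nat \<Rightarrow> nat \<Rightarrow> nat \<Rightarrow> 'a" where
  "sample_point m k j = (SOME x. x \<in> atom m k j)"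

definition tower_mean :: "('a \<Rightarrow> real) \<Rightarrow> nat \<Rightarrow> nat \<Rightarrow> real" where
  "tower_mean g m k = (\<Sum>j<h m k. g (sample_point m k j)) / real (h m k)"

lemma sample_point_atom: "k \<in> towers m \<Longrightarrow> sample_point m k j \<in> atom m k j"
  unfolding sample_point_def using atom_nonempty[of k m j] some_in_eq by blast

lemma sample_point_in: "k \<in> towers m \<Longrightarrow> sample_point m k j \<in> X"
  using sample_point_atom preim_subset by blast

lemma level_constant_mono: "level_constant m g \<Longrightarrow> m \<le> n \<Longrightarrow> level_constant n g"
  unfolding level_constant_def using cell_antimono by blast

lemma level_constant_sample_point:
  assumes "level_constant m g" "k \<in> towers m" "j < h m k" "x \<in> atom m k j"
  shows "g x = g (sample_point m k j)"
proof -
  note p = sample_point_atom[OF assms(2), of j]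
  have "cell m (sample_point m k j) = atom m k j"
    by (simp only: entry_time_eq[OF assms(2,3) p] tower_of_eq[OF assms(2,3) p])
  thus ?thesis using assms(1,4) sample_point_in[OF assms(2)] unfolding level_constant_def by blast
qed

lemma sum_sample_points:
  "k \<in> towers m \<Longrightarrow> (\<Sum>j<h m k. g (sample_point m k j)) = real (h m k) * tower_mean g m k"
  using height_pos[of k m] by (simp add: tower_mean_def)

lemma height_mult_tower_mean_Suc:
  assumes g: "level_constant m g" and l: "l \<in> towers (Suc m)"
  shows "real (h (Suc m) l) * tower_mean g (Suc m) l
    = (\<Sum>k\<in>towers m. real (card (visits m l k)) * (real (h m k) * tower_mean g m k))"
proof -
  have "g (sample_point (Suc m) l (i + j)) = g (sample_point m k j)"
    if "k \<in> towers m" "i \<in> visits m l k" "j < h m k" for k i j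
    using level_constant_sample_point[OF g that(1,3)] atom_visit_add_subset[OF that(2)]
      sample_point_atom[OF l] by blast
  hence "(\<Sum>j<h (Suc m) l. g (sample_point (Suc m) l j))
      = (\<Sum>k\<in>towers m. \<Sum>i\<in>visits m l k. \<Sum>j<h m k. g (sample_point m k j))"
    unfolding sum_tower_eq_sum_visits[OF l] by (intro sum.cong refl) auto
  thus ?thesis by (simp add: sum_sample_points l)
qed

lemma integral_level_constant_mult:
  fixes u :: "'a \<Rightarrow> real"
  assumes g: "level_constant m g" and int: "integrable \<mu> (\<lambda>x. g x * u x)"
    and u: "\<And>k j. k \<in> towers m \<Longrightarrow> j < h m k \<Longrightarrow> (LINT x:atom m k j|\<mu>. u x) = (LINT x:B m k|\<mu>. u x)"
  shows "(LINT x|\<mu>. g x * u x)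
    = (\<Sum>k\<in>towers m. real (h m k) * tower_mean g m k * (LINT x:B m k|\<mu>. u x))"
proof -
  have "(LINT x:atom m k j|\<mu>. g x * u x) = g (sample_point m k j) * (LINT x:B m k|\<mu>. u x)"
    if k: "k \<in> towers m" and j: "j < h m k" for k j
  proof -
    have "(LINT x:atom m k j|\<mu>. g x * u x) = (LINT x:atom m k j|\<mu>. g (sample_point m k j) * u x)"
      using level_constant_sample_point[OF g k j] k by (intro set_lebesgue_integral_cong) auto
    thus ?thesis using u[OF k j] by simp
  qed
  hence "(LINT x|\<mu>. g x * u x)
      = (\<Sum>k\<in>towers m. \<Sum>j<h m k. g (sample_point m k j) * (LINT x:B m k|\<mu>. u x))"
    unfolding integral_eq_sum_atoms[OF int, of m] by (intro sum.cong) auto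
  also have "\<dots> = (\<Sum>k\<in>towers m. real (h m k) * tower_mean g m k * (LINT x:B m k|\<mu>. u x))"
    by (intro sum.cong refl) (simp add: sum_sample_points flip: sum_distrib_right)
  finally show ?thesis .
qed

lemma integral_level_constant:
  assumes "level_constant m g" "integrable \<mu> g"
  shows "(LINT x|\<mu>. g x) = (\<Sum>k\<in>towers m. real (h m k) * base_measure m k * tower_mean g m k)"
  using integral_level_constant_mult[of m g "\<lambda>_. 1"] assms
  by (simp add: set_integral_one measure_atom mult_ac)

end

section \<open>Linearly recurrent systems\<close>

locale linearly_recurrent = kakutani_rohlin X T Ti C B h
  for X :: "'a::metric_space set" and T Ti :: "'a \<Rightarrow> 'a"
    and C :: "nat \<Rightarrow> nat" and B :: "nat \<Rightarrow> nat \<Rightarrow> 'a set" and h :: "nat \<Rightarrow> nat \<Rightarrow> nat" +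
  fixes L \<alpha> :: real
  assumes two_le_L: "2 \<le> L"
    and height_Suc_le: "l \<in> towers (Suc n) \<Longrightarrow> k \<in> towers n \<Longrightarrow> real (h (Suc n) l) \<le> L * real (h n k)"
begin

definition height_dist :: "nat \<Rightarrow> real" where
  "height_dist n = vnorm (C n) (\<lambda>l. \<alpha> * real (h n l))"

lemma dnint_height_le: "k \<in> towers n \<Longrightarrow> dnint (\<alpha> * real (h n k)) \<le> height_dist n"
  unfolding height_dist_def vnorm_def towers_def by (intro Max_ge) auto

lemma height_dist_attained:
  obtains k where "k \<in> towers n" "height_dist n = dnint (\<alpha> * real (h n k))"
proof -
  have "height_dist n \<in> (\<lambda>i. dnint (\<alpha> * real (h n i))) ` towers n"
    unfolding height_dist_def vnorm_def towers_def[symmetric] by (intro Max_in) auto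
  thus ?thesis using that by auto
qed

lemma height_dist_nonneg [simp]: "0 \<le> height_dist n"
  by (rule order_trans[OF dnint_nonneg dnint_height_le[OF one_in_towers]])

lemma vnorm_PH1_eq_height_dist:
  "vnorm (C (n + 2)) (\<lambda>l. \<alpha> * PH1 X T C B h (n + 2) l) = height_dist (n + 2)"
  unfolding height_dist_def vnorm_def using PH1_eq_height[of _ "Suc n"]
  by (intro arg_cong[of _ _ Max] image_cong) (auto simp: towers_def)

lemma sum_card_visits_le:
  assumes l: "l \<in> towers (Suc n)"
  shows "(\<Sum>k\<in>towers n. real (card (visits n l k))) \<le> L"
proof -
  obtain k where k: "k \<in> towers n" "\<And>k'. k' \<in> towers n \<Longrightarrow> h n k \<le> h n k'"
    using arg_min_if_finite(1)[of "towers n" "h n"] arg_min_least[of "towers n" _ "h n"] by auto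
  have "(\<Sum>k'\<in>towers n. real (card (visits n l k'))) * real (h n k)
      \<le> (\<Sum>k'\<in>towers n. real (card (visits n l k')) * real (h n k'))"
    unfolding sum_distrib_right using k(2) by (intro sum_mono mult_left_mono) auto
  also have "\<dots> = real (h (Suc n) l)" by (simp add: height_Suc[OF l])
  also have "\<dots> \<le> L * real (h n k)" by (rule height_Suc_le[OF l k(1)])
  finally show ?thesis using height_pos[OF k(1)] by simp
qed

lemma height_Suc_div_le:
  assumes l: "l \<in> towers (Suc n)" and k: "k \<in> towers n"
  shows "real (h (Suc n) l) / L \<le> real (card (visits n l k)) * real (h n k)"
proof -
  have "real (h (Suc n) l) / L \<le> 1 * real (h n k)"
    using height_Suc_le[OF l k] two_le_L by (simp add: field_simps)
  also have "\<dots> \<le> real (card (visits n l k)) * real (h n k)"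
    using one_le_card_visits[OF k l] by (intro mult_right_mono) auto
  finally show ?thesis .
qed

lemma dnint_visit_le:
  assumes l: "l \<in> towers (Suc n)" and k: "k \<in> towers n" and i: "i \<in> visits n l k"
  shows "dnint (\<alpha> * real i) \<le> L * height_dist n"
proof -
  let ?c = "\<lambda>k'. card {i' \<in> visits n l k'. i' < i}"
  have "real i = (\<Sum>k'\<in>towers n. real (?c k') * real (h n k'))"
    using arg_cong[OF visit_eq_sum_earlier_visits[OF l k i], of real] by simp
  hence "\<alpha> * real i = (\<Sum>k'\<in>towers n. of_nat (?c k') * (\<alpha> * real (h n k')))"
    by (simp add: sum_distrib_left mult_ac)
  hence "dnint (\<alpha> * real i) \<le> (\<Sum>k'\<in>towers n. dnint (of_nat (?c k') * (\<alpha> * real (h n k'))))"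
    using dnint_sum_le by simp
  also have "\<dots> \<le> (\<Sum>k'\<in>towers n. real (card (visits n l k')) * height_dist n)"
  proof (intro sum_mono order_trans[OF dnint_of_nat_mult_le] mult_mono dnint_height_le)
    show "real (?c k') \<le> real (card (visits n l k'))" for k'
      by (intro of_nat_mono card_mono) auto
  qed auto
  also have "\<dots> \<le> L * height_dist n"
    unfolding sum_distrib_right[symmetric] by (intro mult_right_mono sum_card_visits_le l) simp
  finally show ?thesis .
qed

lemma dnint_entry_increment_le:
  "x \<in> X \<Longrightarrow> dnint (\<alpha> * real (entry_increment n x)) \<le> L * height_dist n"
  using dnint_visit_le[OF tower_of_in tower_of_in entry_increment_visit] .

subsection \<open>The phases\<close>

definition phase :: "nat \<Rightarrow> 'a \<Rightarrow> complex" where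
  "phase n x = unit_char (- (\<alpha> * real (entry_time n x)))"

lemma norm_phase [simp]: "norm (phase n x) = 1"
  by (simp add: phase_def)

lemma continuous_on_phase: "continuous_on X (phase n)"
  unfolding phase_def by (rule continuous_on_entry_time)

lemma phase_Suc:
  "x \<in> X \<Longrightarrow> phase (Suc n) x = phase n x * unit_char (- (\<alpha> * real (entry_increment n x)))"
  unfolding phase_def by (simp add: entry_time_Suc algebra_simps flip: unit_char_add)

lemma phase_funpow:
  assumes "x \<in> X" "d \<le> entry_time n x"
  shows "phase n ((T ^^ d) x) = unit_char (\<alpha> * real d) * phase n x"
  unfolding phase_def using assms
  by (simp add: entry_time_funpow of_nat_diff algebra_simps flip: unit_char_add)

lemma eventually_phase_T:
  assumes "x \<in> X" "x \<noteq> base_point"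
  shows "\<forall>\<^sub>F n in sequentially. phase n (T x) = unit_char \<alpha> * phase n x"
  using eventually_entry_time_pos[OF assms]
  by eventually_elim (use phase_funpow[OF assms(1), of 1] in simp)

lemma norm_phase_Suc_diff_le:
  assumes "x \<in> X" shows "norm (phase (Suc n) x - phase n x) \<le> 2 * pi * L * height_dist n"
proof -
  let ?u = "unit_char (- (\<alpha> * real (entry_increment n x)))"
  have "phase (Suc n) x - phase n x = phase n x * (?u - 1)"
    using phase_Suc[OF assms] by (simp add: ring_distribs)
  hence "norm (phase (Suc n) x - phase n x) = norm (?u - 1)" by (simp add: norm_mult)
  also have "\<dots> \<le> 2 * pi * dnint (\<alpha> * real (entry_increment n x))"
    using norm_unit_char_minus_one_le[of "- (\<alpha> * real (entry_increment n x))"] by simp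
  also have "\<dots> \<le> 2 * pi * (L * height_dist n)"
    by (intro mult_left_mono dnint_entry_increment_le assms) auto
  finally show ?thesis by simp
qed

lemma phase_continuous_limit:
  assumes "summable height_dist"
  obtains f where "continuous_on X f" "\<And>x. x \<in> X \<Longrightarrow> (\<lambda>n. phase n x) \<longlonglongrightarrow> f x"
proof -
  let ?d = "\<lambda>n x. phase (Suc n) x - phase n x"
  let ?f = "\<lambda>x. phase 0 x + (\<Sum>i. ?d i x)"
  have uniform: "uniform_limit X (\<lambda>n x. \<Sum>i<n. ?d i x) (\<lambda>x. \<Sum>i. ?d i x) sequentially"
    using norm_phase_Suc_diff_le assms
    by (intro Weierstrass_m_test[of X ?d "\<lambda>n. 2 * pi * L * height_dist n"]) auto
  have "continuous_on X (\<lambda>x. \<Sum>i. ?d i x)"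
    by (rule uniform_limit_theorem[OF _ uniform])
      (auto intro!: always_eventually continuous_intros continuous_on_phase)
  hence "continuous_on X ?f" by (intro continuous_intros continuous_on_phase)
  moreover have "(\<lambda>n. phase n x) \<longlonglongrightarrow> ?f x" if "x \<in> X" for x
  proof -
    have "(\<lambda>n. phase 0 x + (\<Sum>i<n. ?d i x)) \<longlonglongrightarrow> ?f x"
      using tendsto_uniform_limitI[OF uniform that] by (intro tendsto_intros)
    thus ?thesis by (subst (asm) sum_lessThan_telescope) simp
  qed
  ultimately show ?thesis using that by blast
qed

subsection \<open>Defect times\<close>

lemma exists_defect_time:
  "\<exists>e. height_dist n / 2 \<le> dnint (\<alpha> * real e) \<and> e \<le> h (Suc n) 1 \<and>
       (\<forall>y\<in>X. (T ^^ e) y \<in> roof C B (n + 2) \<longrightarrow> y \<in> roof C B n)"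
proof -
  obtain k where k: "k \<in> towers n" "height_dist n = dnint (\<alpha> * real (h n k))"
    by (rule height_dist_attained)
  obtain i where i: "i \<in> visits n 1 k" using visits_nonempty[OF k(1) one_in_towers] by blast
  have atom: "y \<in> atom (Suc n) 1 e" if "y \<in> X" "(T ^^ e) y \<in> roof C B (n + 2)" for y e
    using that roof_Suc_subset_base[of "Suc n"] by (auto simp: preim_def)
  have first: "y \<in> roof C B n" if "y \<in> X" "(T ^^ i) y \<in> roof C B (n + 2)" for y
    using atom[OF that] visit_subset_base[OF i] base_subset_roof[OF k(1)] by blast
  have second: "y \<in> roof C B n" if "y \<in> X" "(T ^^ (i + h n k)) y \<in> roof C B (n + 2)" for y
    using atom[OF that] atom_visit_add_subset[OF i] atom_height_subset_roof[OF k(1)] by blast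
  have le: "i + h n k \<le> h (Suc n) 1"
    by (rule visit_add_height_le_height[OF one_in_towers k(1) i])
  have "\<alpha> * real (h n k) = \<alpha> * real (i + h n k) + - (\<alpha> * real i)" by (simp add: algebra_simps)
  hence "height_dist n \<le> dnint (\<alpha> * real (i + h n k)) + dnint (\<alpha> * real i)"
    using dnint_add_le[of "\<alpha> * real (i + h n k)" "- (\<alpha> * real i)"] k(2) by simp
  hence "height_dist n / 2 \<le> dnint (\<alpha> * real i) \<or> height_dist n / 2 \<le> dnint (\<alpha> * real (i + h n k))"
    by linarith
  thus ?thesis using first second le by (meson add_leD1)
qed

definition defect_time :: "nat \<Rightarrow> nat" where
  "defect_time n = (SOME e. height_dist n / 2 \<le> dnint (\<alpha> * real e) \<and> e \<le> h (Suc n) 1 \<and>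
       (\<forall>y\<in>X. (T ^^ e) y \<in> roof C B (n + 2) \<longrightarrow> y \<in> roof C B n))"

lemma height_dist_le_dnint_defect_time: "height_dist n \<le> 2 * dnint (\<alpha> * real (defect_time n))"
  and defect_time_le: "defect_time n \<le> h (Suc n) 1"
  and funpow_defect_time_roof: "y \<in> X \<Longrightarrow> (T ^^ defect_time n) y \<in> roof C B (n + 2) \<Longrightarrow> y \<in> roof C B n"
  using someI_ex[OF exists_defect_time, of n, folded defect_time_def] by auto

lemma single_tower_if_height_le_defect_time:
  assumes "h (n + 2) 1 \<le> defect_time n"
  shows "towers (Suc n) = {1}" and "defect_time n = h (Suc n) 1"
  using assms defect_time_le[of n] height_le_height_Suc[of 1 "Suc n"]
    towers_eq_1_if_height_le[of 1 "Suc n"] by simp_all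

lemma funpow_sum_defect_times_roof:
  assumes "finite F" "\<And>n. n \<in> F \<Longrightarrow> N \<le> n" "\<And>n. n \<in> F \<Longrightarrow> Suc n \<notin> F"
    and "y \<in> X" "(T ^^ (\<Sum>n\<in>F. defect_time n)) y = base_point"
  shows "y \<in> roof C B N"
  using assms
proof (induction F arbitrary: y N rule: finite_linorder_min_induct)
  case empty
  thus ?case using base_point_roof by simp
next
  case (insert a F)
  have "(\<Sum>n\<in>insert a F. defect_time n) = (\<Sum>n\<in>F. defect_time n) + defect_time a"
    using insert.hyps by (subst sum.insert) auto
  hence "(T ^^ (\<Sum>n\<in>F. defect_time n)) ((T ^^ defect_time a) y) = base_point"
    using insert.prems(4) by (simp add: funpow_add)
  moreover have "a + 2 \<le> n" if "n \<in> F" for n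
  proof -
    have "a < n" "n \<noteq> Suc a" using insert.hyps(2) insert.prems(2)[of a] that by auto
    thus ?thesis by simp
  qed
  ultimately have "(T ^^ defect_time a) y \<in> roof C B (a + 2)"
    using insert.prems(2,3) by (intro insert.IH) (auto intro: funpow_in)
  hence "y \<in> roof C B a" by (rule funpow_defect_time_roof[OF insert.prems(3)])
  thus ?case using roof_antimono[of N a] insert.prems(1) by blast
qed

lemma summable_on_defect_times:
  assumes returns: "\<And>x d. x \<in> roof C B N \<Longrightarrow> (T ^^ d) x \<in> roof C B N \<Longrightarrow> dnint (\<alpha> * real d) \<le> 1 / 4"
    and S: "S \<subseteq> {N..}" "\<And>n. n \<in> S \<Longrightarrow> Suc n \<notin> S"
  shows "(\<lambda>n. dnint (\<alpha> * real (defect_time n))) summable_on S"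
proof -
  have "(\<lambda>n. \<bar>signed_dnint (\<alpha> * real (defect_time n))\<bar>) summable_on S"
  proof (rule summable_on_abs_if_dnint_sum_le)
    fix F assume F: "finite F" "F \<subseteq> S"
    obtain y where y: "y \<in> X" "(T ^^ (\<Sum>n\<in>F. defect_time n)) y = base_point"
      using funpow_surj[OF base_point_in] .
    have "y \<in> roof C B N"
      using F S y by (intro funpow_sum_defect_times_roof[of F]) auto
    hence "dnint (\<alpha> * real (\<Sum>n\<in>F. defect_time n)) \<le> 1 / 4"
      using returns[of y "\<Sum>n\<in>F. defect_time n"] y(2) base_point_roof by simp
    thus "dnint (\<Sum>n\<in>F. signed_dnint (\<alpha> * real (defect_time n))) \<le> 1 / 4"
      by (simp add: dnint_sum_signed_dnint sum_distrib_left)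
  qed (simp only: abs_signed_dnint dnint_le_half)
  thus ?thesis by (simp add: abs_signed_dnint)
qed

lemma summable_height_dist_if_returns:
  assumes returns: "\<And>x d. x \<in> roof C B N \<Longrightarrow> (T ^^ d) x \<in> roof C B N \<Longrightarrow> dnint (\<alpha> * real d) \<le> 1 / 4"
  shows "summable height_dist"
proof -
  let ?r = "\<lambda>n. dnint (\<alpha> * real (defect_time n))"
  have "?r summable_on {n. N \<le> n \<and> even n}" "?r summable_on {n. N \<le> n \<and> odd n}"
    by (intro summable_on_defect_times[OF returns]; auto)+
  moreover have "?r summable_on {..<N}" by simp
  ultimately have "?r summable_on ({n. N \<le> n \<and> even n} \<union> {n. N \<le> n \<and> odd n} \<union> {..<N})"
    by (intro summable_on_union)
  moreover have "{n. N \<le> n \<and> even n} \<union> {n. N \<le> n \<and> odd n} \<union> {..<N} = UNIV" by auto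
  ultimately have "summable ?r" by (simp add: summable_on_UNIV_nonneg_real_iff)
  hence "summable (\<lambda>n. 2 * ?r n)" by (rule summable_mult)
  thus ?thesis
    by (rule summable_comparison_test'[where N = 0]) (simp add: height_dist_le_dnint_defect_time)
qed

end

locale linearly_recurrent_measure =
  linearly_recurrent X T Ti C B h L \<alpha> + kakutani_rohlin_measure X T Ti C B h \<mu>
  for X :: "'a::metric_space set" and T Ti :: "'a \<Rightarrow> 'a"
    and C :: "nat \<Rightarrow> nat" and B :: "nat \<Rightarrow> nat \<Rightarrow> 'a set" and h :: "nat \<Rightarrow> nat \<Rightarrow> nat"
    and L \<alpha> :: real and \<mu> :: "'a measure" +
  assumes minimal: "minimal_cantor_system X T Ti"
begin

section \<open>Continuous eigenvalues\<close>

lemma dense_orbit: "x \<in> X \<Longrightarrow> X \<subseteq> closure (orbit T Ti x)"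
  using minimal by (simp add: minimal_cantor_system_def)

lemma AE_neq_base_point: "AE x in \<mu>. x \<noteq> base_point"
proof (rule AE_neq_aperiodic_point[OF base_point_in])
  have "base_point islimpt X"
    using minimal base_point_in by (simp add: minimal_cantor_system_def cantor_space_def)
  hence "infinite X" using islimpt_finite by blast
  thus "(T ^^ p) base_point \<noteq> base_point" if "0 < p" for p
    using dense_orbit_aperiodic base_point_in dense_orbit that by blast
qed

lemma phase_measurable [measurable]: "phase n \<in> borel_measurable \<mu>"
  by (rule continuous_on_measurable[OF continuous_on_phase])

lemma AE_eigen_limit_phase:
  fixes \<kappa> :: "nat \<Rightarrow> complex"
  assumes r: "strict_mono r" and lim: "AE x in \<mu>. (\<lambda>n. \<kappa> n * phase (r n) x) \<longlonglongrightarrow> f x"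
  shows "AE x in \<mu>. f (T x) = unit_char \<alpha> * f x"
  using lim AE_funpow[OF lim, of 1] AE_neq_base_point AE_space
proof eventually_elim
  case (elim x)
  have "\<forall>\<^sub>F n in sequentially. phase (r n) (T x) = unit_char \<alpha> * phase (r n) x"
    using eventually_phase_T[of x] elim eventually_subseq[OF r] by simp
  hence "\<forall>\<^sub>F n in sequentially. \<kappa> n * phase (r n) (T x) = unit_char \<alpha> * (\<kappa> n * phase (r n) x)"
    by eventually_elim simp
  moreover have "(\<lambda>n. unit_char \<alpha> * (\<kappa> n * phase (r n) x)) \<longlonglongrightarrow> unit_char \<alpha> * f x"
    using elim(1) by (intro tendsto_intros)
  ultimately have "(\<lambda>n. \<kappa> n * phase (r n) (T x)) \<longlonglongrightarrow> unit_char \<alpha> * f x"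
    by (rule tendsto_cong[THEN iffD2])
  thus ?case using elim(2) LIMSEQ_unique by simp
qed

lemma summable_imp_continuous_eigenvalue:
  assumes "summable height_dist" shows "continuous_eigenvalue X \<mu> T (unit_char \<alpha>)"
proof -
  obtain f where f: "continuous_on X f" "\<And>x. x \<in> X \<Longrightarrow> (\<lambda>n. phase n x) \<longlonglongrightarrow> f x"
    using phase_continuous_limit[OF assms] by blast
  have measurable: "f \<in> borel_measurable \<mu>" by (rule continuous_on_measurable[OF f(1)])
  have "norm (f x) = 1" if "x \<in> X" for x
    using tendsto_norm[OF f(2)[OF that]] by (simp add: LIMSEQ_const_iff)
  hence unimodular: "AE x in \<mu>. norm (f x) = 1" by (intro AE_I2) simp
  have "AE x in \<mu>. f (T x) = unit_char \<alpha> * f x"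
    using f(2) by (intro AE_eigen_limit_phase[of id "\<lambda>_. 1"]) (auto simp: strict_mono_def)
  thus ?thesis
    unfolding continuous_eigenvalue_def
    using f(1) measurable unimodular_square_integrable[OF measurable unimodular]
      unimodular_not_AE_zero[OF measurable unimodular] by blast
qed

lemma continuous_eigenfunction:
  assumes "continuous_eigenvalue X \<mu> T (unit_char \<alpha>)"
  obtains f where "continuous_on X f" "f base_point \<noteq> (0 :: complex)"
    "\<And>x d. x \<in> X \<Longrightarrow> f ((T ^^ d) x) = unit_char (\<alpha> * real d) * f x"
proof -
  obtain f where f: "continuous_on X f" "\<not> (AE x in \<mu>. f x = 0)"
      "AE x in \<mu>. f (T x) = unit_char \<alpha> * f x"
    using assms unfolding continuous_eigenvalue_def by blast
  have "continuous_on X (\<lambda>x. f (T x) - unit_char \<alpha> * f x)"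
    using homeo T_in by (intro continuous_intros f(1) continuous_on_compose2[OF f(1), of X T])
      (auto simp: homeomorphism_def)
  moreover have "AE x in \<mu>. f (T x) - unit_char \<alpha> * f x = 0" using f(3) by eventually_elim simp
  ultimately have eigen: "f (T x) = unit_char \<alpha> * f x" if "x \<in> X" for x
    using AE_zero_imp_zero[of "\<lambda>x. f (T x) - unit_char \<alpha> * f x" x] that by simp
  show thesis
  proof (rule that[OF f(1)])
    show "f base_point \<noteq> 0"
    proof
      assume zero: "f base_point = 0"
      have "f x = 0" if "x \<in> X" for x
        by (rule dense_orbit_eigen_zero[OF f(1) eigen unit_char_nonzero base_point_in zero
              dense_orbit[OF base_point_in] that])
      hence "AE x in \<mu>. f x = 0" by (intro AE_I2) simp
      thus False using f(2) by blast
    qed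
    show "f ((T ^^ d) x) = unit_char (\<alpha> * real d) * f x" if "x \<in> X" for x d
      by (induction d) (simp_all add: eigen funpow_in that unit_char_add ring_distribs)
  qed
qed

lemma continuous_eigenvalue_imp_returns:
  assumes "continuous_eigenvalue X \<mu> T (unit_char \<alpha>)" and "0 < \<epsilon>"
  obtains N where "\<And>x d. x \<in> roof C B N \<Longrightarrow> (T ^^ d) x \<in> roof C B N \<Longrightarrow> dnint (\<alpha> * real d) \<le> \<epsilon>"
proof -
  obtain f where f: "continuous_on X f" "f base_point \<noteq> (0 :: complex)"
      "\<And>x d. x \<in> X \<Longrightarrow> f ((T ^^ d) x) = unit_char (\<alpha> * real d) * f x"
    using continuous_eigenfunction[OF assms(1)] by blast
  let ?z = "f base_point"
  let ?U = "X \<inter> f -` ball ?z (2 * \<epsilon> * norm ?z)"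
  have "openin (top_of_set X) ?U"
    by (intro continuous_openin_preimage_gen f(1)) auto
  moreover have "base_point \<in> ?U" using base_point_in f(2) \<open>0 < \<epsilon>\<close> by simp
  ultimately obtain N where N: "roof C B N \<subseteq> ?U" by (rule roof_basis_base_point)
  have "dnint (\<alpha> * real d) \<le> \<epsilon>" if x: "x \<in> roof C B N" "(T ^^ d) x \<in> roof C B N" for x d
  proof -
    let ?u = "unit_char (\<alpha> * real d)"
    have near: "norm (?z - f x) \<le> 2 * \<epsilon> * norm ?z" "norm (f ((T ^^ d) x) - ?z) \<le> 2 * \<epsilon> * norm ?z"
      using N x by (auto simp: dist_norm norm_minus_commute less_imp_le subset_eq)
    have "(?u - 1) * ?z = ?u * (?z - f x) + (f ((T ^^ d) x) - ?z)"
      using f(3)[of x d] x(1) roof_subset by (auto simp: ring_distribs)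
    hence "norm (?u - 1) * norm ?z \<le> norm (?u * (?z - f x)) + norm (f ((T ^^ d) x) - ?z)"
      by (metis norm_mult norm_triangle_ineq)
    also have "\<dots> \<le> 4 * \<epsilon> * norm ?z" using near by (simp add: norm_mult)
    finally have "norm (?u - 1) \<le> 4 * \<epsilon>" using f(2) by simp
    thus ?thesis using dnint_le_norm_unit_char_minus_one[of "\<alpha> * real d"] by simp
  qed
  thus ?thesis by (rule that)
qed

lemma continuous_eigenvalue_imp_summable:
  assumes "continuous_eigenvalue X \<mu> T (unit_char \<alpha>)" shows "summable height_dist"
  using continuous_eigenvalue_imp_returns[OF assms, of "1 / 4"] summable_height_dist_if_returns
  by auto

section \<open>Measurable eigenvalues: necessity\<close>

lemma height_base_measure_ge:
  assumes k: "k \<in> towers n" shows "1 / L \<le> real (h n k) * base_measure n k"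
proof -
  have "1 / L = (\<Sum>l\<in>towers (Suc n). real (h (Suc n) l) / L * base_measure (Suc n) l)"
    using sum_height_base_measure[of "Suc n"] by (simp flip: sum_divide_distrib)
  also have "\<dots> \<le> (\<Sum>l\<in>towers (Suc n).
      real (card (visits n l k)) * real (h n k) * base_measure (Suc n) l)"
    by (intro sum_mono mult_right_mono height_Suc_div_le k) auto
  also have "\<dots> = real (h n k) * base_measure n k"
    unfolding base_measure_rec[OF k] sum_distrib_left by (intro sum.cong) (auto simp: mult_ac)
  finally show ?thesis .
qed

context
  fixes f :: "'a \<Rightarrow> complex"
  assumes f_measurable [measurable]: "f \<in> borel_measurable \<mu>"
    and f_square_integrable: "integrable \<mu> (\<lambda>x. (norm (f x))\<^sup>2)"
    and f_eigen: "AE x in \<mu>. f (T x) = unit_char \<alpha> * f x"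
begin

lemma f_integrable: "integrable \<mu> f"
proof (rule square_integrable_imp_integrable)
  show "integrable \<mu> (\<lambda>x. (f x)\<^sup>2)"
    using f_square_integrable
    by (intro integrable_norm_cancel[of \<mu> "\<lambda>x. (f x)\<^sup>2"]) (simp_all add: norm_power)
qed simp

definition base_mean :: "nat \<Rightarrow> nat \<Rightarrow> complex" where
  "base_mean n k = (LINT x:B n k|\<mu>. f x) / of_real (base_measure n k)"

text \<open>The conditional expectation of \<open>f\<close> on the partition of level \<open>n\<close>.\<close>

definition cond_mean :: "nat \<Rightarrow> 'a \<Rightarrow> complex" where
  "cond_mean n x = phase n x * base_mean n (tower_of n x)"

definition energy :: "nat \<Rightarrow> real" where
  "energy n = (\<Sum>k\<in>towers n. real (h n k) * (base_measure n k * (norm (base_mean n k))\<^sup>2))"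

lemma set_integral_base:
  "k \<in> towers n \<Longrightarrow> (LINT x:B n k|\<mu>. f x) = base_measure n k *\<^sub>R base_mean n k"
  using base_measure_pos[of k n] by (simp add: base_mean_def scaleR_conv_of_real)

lemma set_integral_atom:
  assumes "k \<in> towers n"
  shows "(LINT x:atom n k j|\<mu>. f x)
    = base_measure n k *\<^sub>R (unit_char (- (\<alpha> * real j)) * base_mean n k)"
proof -
  have "unit_char (\<alpha> * real j) * (LINT x:atom n k j|\<mu>. f x) = (LINT x:B n k|\<mu>. f x)"
    using assms by (intro set_integral_preim_eigen AE_eigen_funpow f_eigen) auto
  hence "(LINT x:atom n k j|\<mu>. f x) = unit_char (- (\<alpha> * real j)) * (LINT x:B n k|\<mu>. f x)"
    by (simp add: unit_char_minus field_simps)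
  thus ?thesis by (simp add: set_integral_base[OF assms])
qed

definition visit_deviation :: "nat \<Rightarrow> nat \<Rightarrow> nat \<Rightarrow> nat \<Rightarrow> real" where
  "visit_deviation n k l i
    = norm (unit_char (- (\<alpha> * real i)) * base_mean (Suc n) l - base_mean n k)"

lemma norm_cond_mean_Suc_diff:
  assumes "x \<in> X"
  shows "norm (cond_mean (Suc n) x - cond_mean n x)
    = visit_deviation n (tower_of n x) (tower_of (Suc n) x) (entry_increment n x)"
proof -
  let ?u = "unit_char (- (\<alpha> * real (entry_increment n x)))"
  have "cond_mean (Suc n) x - cond_mean n x
      = phase n x * (?u * base_mean (Suc n) (tower_of (Suc n) x) - base_mean n (tower_of n x))"
    by (simp add: cond_mean_def phase_Suc[OF assms] ring_distribs)
  thus ?thesis by (simp add: norm_mult visit_deviation_def)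
qed

lemma sum_visit_deviation_square:
  assumes k: "k \<in> towers n"
  shows "(\<Sum>l\<in>towers (Suc n). \<Sum>i\<in>visits n l k. base_measure (Suc n) l * (visit_deviation n k l i)\<^sup>2)
    = (\<Sum>l\<in>towers (Suc n).
        real (card (visits n l k)) * (base_measure (Suc n) l * (norm (base_mean (Suc n) l))\<^sup>2))
      - base_measure n k * (norm (base_mean n k))\<^sup>2"
proof -
  let ?I = "SIGMA l:towers (Suc n). visits n l k"
  let ?p = "\<lambda>(l, i). base_measure (Suc n) l"
    and ?z = "\<lambda>(l, i). unit_char (- (\<alpha> * real i)) * base_mean (Suc n) l"
  have split: "(\<Sum>l\<in>towers (Suc n). \<Sum>i\<in>visits n l k. F l i) = (\<Sum>(l, i)\<in>?I. F l i)"
    for F :: "nat \<Rightarrow> nat \<Rightarrow> 'z::comm_monoid_add"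
    by (subst sum.Sigma) auto
  have weight: "(\<Sum>t\<in>?I. ?p t) = base_measure n k"
    using split[of "\<lambda>l i. base_measure (Suc n) l"] base_measure_rec[OF k] by simp
  have "base_measure n k *\<^sub>R base_mean n k = (\<Sum>t\<in>?I. ?p t *\<^sub>R ?z t)"
    unfolding set_integral_base[OF k, symmetric]
      set_integral_base_eq_sum_visits[OF f_integrable k] split
    by (intro sum.cong) (auto simp: set_integral_atom)
  hence "(\<Sum>t\<in>?I. ?p t *\<^sub>R ?z t) = (\<Sum>t\<in>?I. ?p t) *\<^sub>R base_mean n k" unfolding weight ..
  from sum_weighted_norm_diff_square[OF this]
  have "(\<Sum>t\<in>?I. ?p t * (norm (?z t - base_mean n k))\<^sup>2)
      = (\<Sum>t\<in>?I. ?p t * (norm (?z t))\<^sup>2) - base_measure n k * (norm (base_mean n k))\<^sup>2"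
    unfolding weight .
  thus ?thesis
    using split[of "\<lambda>l i. base_measure (Suc n) l * (visit_deviation n k l i)\<^sup>2"]
      split[of "\<lambda>l i. base_measure (Suc n) l * (norm (?z (l, i)))\<^sup>2"]
    by (simp add: case_prod_unfold norm_mult visit_deviation_def)
qed

lemma energy_Suc_diff:
  "energy (Suc n) - energy n = (\<Sum>k\<in>towers n. real (h n k) *
    (\<Sum>l\<in>towers (Suc n). \<Sum>i\<in>visits n l k. base_measure (Suc n) l * (visit_deviation n k l i)\<^sup>2))"
proof -
  let ?e = "\<lambda>l. base_measure (Suc n) l * (norm (base_mean (Suc n) l))\<^sup>2"
    and ?c = "\<lambda>l k. real (card (visits n l k))"
  have "energy (Suc n) = (\<Sum>l\<in>towers (Suc n). \<Sum>k\<in>towers n. ?c l k * real (h n k) * ?e l)"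
    unfolding energy_def by (intro sum.cong refl) (simp add: height_Suc sum_distrib_right)
  also have "\<dots> = (\<Sum>k\<in>towers n. \<Sum>l\<in>towers (Suc n). ?c l k * real (h n k) * ?e l)"
    by (rule sum.swap)
  also have "\<dots> = (\<Sum>k\<in>towers n. real (h n k) * (\<Sum>l\<in>towers (Suc n). ?c l k * ?e l))"
    by (intro sum.cong refl) (simp add: sum_distrib_left mult_ac)
  finally show ?thesis
    unfolding energy_def[of n]
    by (simp add: sum_visit_deviation_square right_diff_distrib sum_subtractf cong: sum.cong)
qed

lemma energy_Suc_ge: "energy n \<le> energy (Suc n)"
proof -
  have "0 \<le> energy (Suc n) - energy n"
    unfolding energy_Suc_diff by (intro sum_nonneg mult_nonneg_nonneg) auto
  thus ?thesis by simp
qed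

lemma height_mult_visit_deviation_square_le:
  assumes k: "k \<in> towers n" and l: "l \<in> towers (Suc n)" and i: "i \<in> visits n l k"
  shows "real (h n k) * (base_measure (Suc n) l * (visit_deviation n k l i)\<^sup>2)
    \<le> energy (Suc n) - energy n"
proof -
  let ?q = "\<lambda>k l i. base_measure (Suc n) l * (visit_deviation n k l i)\<^sup>2"
  have "?q k l i \<le> (\<Sum>i\<in>visits n l k. ?q k l i)"
    by (intro member_le_sum i) auto
  also have "\<dots> \<le> (\<Sum>l\<in>towers (Suc n). \<Sum>i\<in>visits n l k. ?q k l i)"
    by (rule member_le_sum[OF l]) (auto intro!: sum_nonneg)
  finally have "real (h n k) * ?q k l i
      \<le> real (h n k) * (\<Sum>l\<in>towers (Suc n). \<Sum>i\<in>visits n l k. ?q k l i)"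
    by (rule mult_left_mono) simp
  also have "\<dots> \<le> energy (Suc n) - energy n"
    unfolding energy_Suc_diff
    by (rule member_le_sum[OF k]) (auto intro!: sum_nonneg mult_nonneg_nonneg)
  finally show ?thesis .
qed

lemma visit_deviation_square_le:
  assumes k: "k \<in> towers n" and l: "l \<in> towers (Suc n)" and i: "i \<in> visits n l k"
  shows "(visit_deviation n k l i)\<^sup>2 \<le> L\<^sup>2 * (energy (Suc n) - energy n)"
proof -
  let ?d = "(visit_deviation n k l i)\<^sup>2"
  have "1 / L * ?d \<le> real (h (Suc n) l) * base_measure (Suc n) l * ?d"
    by (intro mult_right_mono height_base_measure_ge l) simp
  also have "\<dots> \<le> L * real (h n k) * base_measure (Suc n) l * ?d"
    by (intro mult_right_mono height_Suc_le l k) auto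
  also have "\<dots> = L * (real (h n k) * (base_measure (Suc n) l * ?d))" by (simp add: mult.assoc)
  also have "\<dots> \<le> L * (energy (Suc n) - energy n)"
    using height_mult_visit_deviation_square_le[OF assms] two_le_L by (intro mult_left_mono) auto
  finally have "L * (1 / L * ?d) \<le> L * (L * (energy (Suc n) - energy n))"
    using two_le_L by (intro mult_left_mono) auto
  thus ?thesis using two_le_L by (simp add: power2_eq_square mult.assoc)
qed

lemma energy_mono: "m \<le> n \<Longrightarrow> energy m \<le> energy n"
  by (rule lift_Suc_mono_le[of energy, OF energy_Suc_ge])

lemma energy_le: "energy n \<le> (LINT x|\<mu>. (norm (f x))\<^sup>2)"
proof -
  have "(LINT x:atom n k j|\<mu>. (norm (f x))\<^sup>2) = (LINT x:B n k|\<mu>. (norm (f x))\<^sup>2)"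
    if "k \<in> towers n" for k j
  proof -
    have "AE x in \<mu>. (norm (f ((T ^^ j) x)))\<^sup>2 = 1 * (norm (f x))\<^sup>2"
      using AE_eigen_funpow[OF f_eigen, of j] by eventually_elim (simp add: norm_mult)
    from set_integral_preim_eigen[OF _ base_sets[OF that] this] show ?thesis by simp
  qed
  hence "(LINT x|\<mu>. (norm (f x))\<^sup>2)
      = (\<Sum>k\<in>towers n. real (h n k) * (LINT x:B n k|\<mu>. (norm (f x))\<^sup>2))"
    unfolding integral_eq_sum_atoms[OF f_square_integrable, of n] by (intro sum.cong) auto
  also have "\<dots> \<ge> energy n"
    unfolding energy_def
    by (intro sum_mono mult_left_mono set_integral_norm_square_ge f_integrable f_square_integrable
        set_integral_base base_sets) auto
  finally show ?thesis .
qed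

definition jump :: "nat \<Rightarrow> real" where
  "jump n = L * sqrt (energy (Suc n) - energy n)"

lemma jump_square: "(jump n)\<^sup>2 = L\<^sup>2 * (energy (Suc n) - energy n)"
  using energy_Suc_ge[of n] by (simp add: jump_def power_mult_distrib)

lemma jump_nonneg: "0 \<le> jump n"
  using energy_Suc_ge[of n] two_le_L by (simp add: jump_def)

lemma summable_jump_square: "summable (\<lambda>n. (jump n)\<^sup>2)"
proof -
  have "incseq energy" using energy_mono by (simp add: incseq_def)
  then obtain e where "energy \<longlonglongrightarrow> e" using energy_le by (metis incseq_convergent)
  from telescope_summable[OF this] show ?thesis unfolding jump_square by (rule summable_mult)
qed

lemma norm_cond_mean_Suc_diff_le:
  assumes "x \<in> X" shows "norm (cond_mean (Suc n) x - cond_mean n x) \<le> jump n"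
proof (rule power2_le_imp_le)
  show "(norm (cond_mean (Suc n) x - cond_mean n x))\<^sup>2 \<le> (jump n)\<^sup>2"
    unfolding norm_cond_mean_Suc_diff[OF assms] jump_square
    by (intro visit_deviation_square_le tower_of_in entry_increment_visit assms)
qed (rule jump_nonneg)

lemma cond_mean_roof:
  assumes "x \<in> roof C B n" shows "cond_mean n x = base_mean n (tower_of n x)"
proof -
  have "entry_time n x = 0" using entry_time_eq_0_iff[of x n] assms roof_subset by blast
  thus ?thesis by (simp add: cond_mean_def phase_def)
qed

lemma cond_mean_base: "k \<in> towers n \<Longrightarrow> x \<in> B n k \<Longrightarrow> cond_mean n x = base_mean n k"
  using cond_mean_roof[of x n] base_subset_roof[of k n] by (auto simp: tower_of_base)

lemma norm_base_mean_Suc_diff_le: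
  assumes k: "k \<in> towers (Suc n)" shows "norm (base_mean (Suc n) k - base_mean n 1) \<le> jump n"
proof -
  obtain x where x: "x \<in> B (Suc n) k" using base_nonempty[OF k] by blast
  moreover have base: "x \<in> B n 1" using x base_subset_roof[OF k] roof_Suc_subset_base by blast
  ultimately show ?thesis
    using norm_cond_mean_Suc_diff_le[of x n] base_subset[OF k]
    by (simp only: cond_mean_base[OF k x] cond_mean_base[OF one_in_towers base] subset_iff)
qed

lemma norm_base_mean_diff_le:
  assumes "k \<in> towers (Suc n)" "k' \<in> towers (Suc n)"
  shows "norm (base_mean (Suc n) k - base_mean (Suc n) k') \<le> 2 * jump n"
proof -
  have "norm ((base_mean (Suc n) k - base_mean n 1) - (base_mean (Suc n) k' - base_mean n 1))
      \<le> jump n + jump n"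
    by (intro norm_triangle_le_diff add_mono norm_base_mean_Suc_diff_le assms)
  thus ?thesis by simp
qed

lemma norm_cond_mean_diff_two_levels_le:
  assumes "x \<in> X"
  shows "norm (cond_mean (n + 2) x - cond_mean n x) \<le> jump n + jump (Suc n)"
proof -
  let ?c = "\<lambda>m. cond_mean m x"
  have "norm ((?c (Suc n) - ?c n) + (?c (Suc (Suc n)) - ?c (Suc n))) \<le> jump n + jump (Suc n)"
    by (intro norm_triangle_le add_mono norm_cond_mean_Suc_diff_le assms)
  thus ?thesis by simp
qed

lemma norm_return_defect_le:
  assumes x: "x \<in> roof C B n" "(T ^^ d) x \<in> roof C B n" and d: "d \<le> entry_time (n + 2) x"
  shows "norm (unit_char (\<alpha> * real d) * base_mean n (tower_of n x)
      - base_mean n (tower_of n ((T ^^ d) x))) \<le> 2 * jump n + 2 * jump (Suc n)"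
proof -
  let ?y = "(T ^^ d) x" and ?u = "unit_char (\<alpha> * real d)"
  let ?D = "\<lambda>z. cond_mean (n + 2) z - cond_mean n z"
  have X: "x \<in> X" "?y \<in> X" using x roof_subset by blast+
  have "cond_mean (n + 2) ?y = ?u * cond_mean (n + 2) x"
    unfolding cond_mean_def phase_funpow[OF X(1) d] tower_of_funpow[OF X(1) d] by simp
  hence "?u * cond_mean n x - cond_mean n ?y = ?D ?y - ?u * ?D x" by (simp add: ring_distribs)
  hence "norm (?u * cond_mean n x - cond_mean n ?y) \<le> norm (?D ?y) + norm (?u * ?D x)"
    by (simp only: norm_triangle_ineq4)
  also have "\<dots> \<le> 2 * jump n + 2 * jump (Suc n)"
    using norm_cond_mean_diff_two_levels_le[OF X(1), of n]
      norm_cond_mean_diff_two_levels_le[OF X(2), of n] by (simp add: norm_mult)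
  finally show ?thesis by (simp only: cond_mean_roof x)
qed

lemma single_tower_period:
  assumes towers: "towers n = {1}" and nonzero: "base_mean n 1 \<noteq> 0"
  shows "dnint (\<alpha> * real (h n 1)) = 0"
proof -
  let ?u = "unit_char (\<alpha> * real (h n 1))"
  have "(LINT x:B n 1|\<mu>. f x) \<noteq> 0"
    unfolding set_integral_base[OF one_in_towers]
    using nonzero base_measure_pos[OF one_in_towers, of n] by simp
  moreover have "?u * (LINT x:atom n 1 (h n 1)|\<mu>. f x) = (LINT x:B n 1|\<mu>. f x)"
    by (intro set_integral_preim_eigen AE_eigen_funpow f_eigen) auto
  ultimately have "?u = 1" unfolding single_tower_periodic[OF towers] by simp
  thus ?thesis
    using dnint_le_norm_unit_char_minus_one[of "\<alpha> * real (h n 1)"]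
    by (intro antisym dnint_nonneg) simp
qed

lemma norm_period_defect_le:
  assumes x: "x \<in> roof C B (Suc m)" "(T ^^ d) x \<in> roof C B (Suc m)"
    and d: "d \<le> entry_time (Suc m + 2) x"
  shows "norm (unit_char (\<alpha> * real d) - 1) * norm (base_mean (Suc m) (tower_of (Suc m) x))
    \<le> 2 * (\<Sum>i<3. jump (m + i))"
proof -
  let ?u = "unit_char (\<alpha> * real d)" and ?a = "base_mean (Suc m) (tower_of (Suc m) x)"
    and ?b = "base_mean (Suc m) (tower_of (Suc m) ((T ^^ d) x))"
  have "norm ((?u - 1) * ?a) = norm ((?u * ?a - ?b) + (?b - ?a))" by (simp add: ring_distribs)
  also have "\<dots> \<le> norm (?u * ?a - ?b) + norm (?b - ?a)" by (rule norm_triangle_ineq)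
  also have "\<dots> \<le> (2 * jump (Suc m) + 2 * jump (Suc (Suc m))) + 2 * jump m"
    using x roof_subset
    by (intro add_mono norm_return_defect_le[OF x d] norm_base_mean_diff_le tower_of_in) auto
  also have "\<dots> = 2 * (\<Sum>i<3. jump (m + i))" by (simp add: eval_nat_numeral)
  finally show ?thesis by (simp only: norm_mult)
qed

lemma height_dist_mult_le_jumps:
  assumes "0 < c" and below: "\<And>n k. m \<le> n \<Longrightarrow> k \<in> towers n \<Longrightarrow> c \<le> norm (base_mean n k)"
  shows "height_dist (Suc m) * c \<le> (\<Sum>i<3. jump (m + i))"
proof -
  let ?n = "Suc m"
  let ?e = "defect_time ?n"
  show ?thesis
  proof (cases "?e < h (?n + 2) 1")
    case True
    obtain x where x: "x \<in> atom (?n + 2) 1 ?e" using atom_nonempty[OF one_in_towers] by blast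
    hence "x \<in> X" and "(T ^^ ?e) x \<in> roof C B (?n + 2)"
      using base_subset_roof[OF one_in_towers] by (auto simp: preim_def)
    hence roofs: "x \<in> roof C B ?n" "(T ^^ ?e) x \<in> roof C B ?n"
      using funpow_defect_time_roof roof_antimono[of ?n "?n + 2"] by auto
    let ?u = "unit_char (\<alpha> * real ?e)" and ?a = "base_mean ?n (tower_of ?n x)"
    have "entry_time (?n + 2) x = ?e" using entry_time_eq[OF one_in_towers True x] .
    hence "norm (?u - 1) * norm ?a \<le> 2 * (\<Sum>i<3. jump (m + i))"
      using norm_period_defect_le[OF roofs] by simp
    moreover have "(4 * dnint (\<alpha> * real ?e)) * c \<le> norm (?u - 1) * norm ?a"
      using \<open>0 < c\<close> below tower_of_in[OF \<open>x \<in> X\<close>]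
      by (intro mult_mono dnint_le_norm_unit_char_minus_one) auto
    moreover have "2 * height_dist ?n * c \<le> (4 * dnint (\<alpha> * real ?e)) * c"
      using \<open>0 < c\<close> height_dist_le_dnint_defect_time[of ?n] by (intro mult_right_mono) auto
    ultimately show ?thesis by linarith
  next
    case False
    hence "towers (Suc ?n) = {1}" "?e = h (Suc ?n) 1"
      using single_tower_if_height_le_defect_time[of ?n] by simp_all
    moreover have "base_mean (Suc ?n) 1 \<noteq> 0" using \<open>0 < c\<close> below[of "Suc ?n" 1] by auto
    ultimately have "dnint (\<alpha> * real ?e) = 0" using single_tower_period by simp
    hence "height_dist ?n = 0"
      using height_dist_le_dnint_defect_time[of ?n] height_dist_nonneg[of ?n] by simp
    thus ?thesis by (simp add: sum_nonneg jump_nonneg)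
  qed
qed

lemma exists_energy_pos:
  assumes "\<not> (AE x in \<mu>. f x = 0)" obtains n where "0 < energy n"
proof (rule ccontr)
  assume "\<not> thesis"
  hence energy: "energy n \<le> 0" for n using that by (meson not_less)
  have "base_mean n k = 0" if k: "k \<in> towers n" for n k
  proof -
    have "real (h n k) * (base_measure n k * (norm (base_mean n k))\<^sup>2) \<le> energy n"
      unfolding energy_def by (rule member_le_sum[OF k]) auto
    hence "real (h n k) * (base_measure n k * (norm (base_mean n k))\<^sup>2) \<le> 0"
      using energy[of n] by linarith
    thus ?thesis using height_pos[OF k] base_measure_pos[OF k] by (auto simp: mult_le_0_iff)
  qed
  hence "AE x in \<mu>. f x = 0"
    by (intro AE_zero_if_atom_integrals_zero f_integrable) (simp add: set_integral_atom)
  thus False using assms by simp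
qed

lemma energy_le_norm_base_mean_square: "\<exists>k\<in>towers n. energy n \<le> (norm (base_mean n k))\<^sup>2"
proof (rule ccontr)
  assume "\<not> ?thesis"
  hence less: "(norm (base_mean n k))\<^sup>2 < energy n" if "k \<in> towers n" for k
    using that by auto
  have "energy n < (\<Sum>k\<in>towers n. real (h n k) * (base_measure n k * energy n))"
    unfolding energy_def[of n] using less height_pos base_measure_pos
    by (intro sum_strict_mono mult_strict_left_mono) (auto simp: energy_def)
  also have "\<dots> = energy n"
    using sum_height_base_measure[of n] by (simp flip: mult.assoc sum_distrib_right)
  finally show False by simp
qed

lemma base_means_bounded_below:
  assumes "\<not> (AE x in \<mu>. f x = 0)"
  obtains c N where "0 < c" "\<And>n k. N \<le> n \<Longrightarrow> k \<in> towers n \<Longrightarrow> c \<le> norm (base_mean n k)"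
proof -
  obtain M where "0 < energy M" using exists_energy_pos[OF assms] .
  define s where "s = sqrt (energy M)"
  have "0 < s" and s_square: "s\<^sup>2 = energy M" using \<open>0 < energy M\<close> by (simp_all add: s_def)
  have "jump \<longlonglongrightarrow> 0" using summable_LIMSEQ_zero[OF summable_jump_square] by simp
  hence "\<forall>\<^sub>F n in sequentially. jump n < s / 4" using \<open>0 < s\<close> by (intro order_tendstoD(2)) auto
  then obtain N where small: "\<And>n. N \<le> n \<Longrightarrow> jump n < s / 4"
    unfolding eventually_sequentially by blast
  have "s / 2 \<le> norm (base_mean n k)" if n: "Suc (max M N) \<le> n" and k: "k \<in> towers n" for n k
  proof -
    obtain m where m: "n = Suc m" "M \<le> n" "N \<le> m" using n by (cases n) auto
    obtain k' where k': "k' \<in> towers n" "energy n \<le> (norm (base_mean n k'))\<^sup>2"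
      using energy_le_norm_base_mean_square by blast
    have "s\<^sup>2 \<le> (norm (base_mean n k'))\<^sup>2" using energy_mono[OF m(2)] k'(2) s_square by simp
    hence "s \<le> norm (base_mean n k')" by (rule power2_le_imp_le) simp
    moreover have "jump m < s / 4" by (rule small[OF m(3)])
    moreover have "norm (base_mean n k' - base_mean n k) \<le> 2 * jump m"
      using norm_base_mean_diff_le k k'(1) m(1) by simp
    ultimately show ?thesis
      using norm_triangle_ineq2[of "base_mean n k'" "base_mean n k"] by linarith
  qed
  thus ?thesis using \<open>0 < s\<close> by (intro that[of "s / 2"]) auto
qed

lemma summable_height_dist_square:
  assumes "\<not> (AE x in \<mu>. f x = 0)" shows "summable (\<lambda>n. (height_dist n)\<^sup>2)"
proof -
  obtain c N where "0 < c" and below: "\<And>n k. N \<le> n \<Longrightarrow> k \<in> towers n \<Longrightarrow> c \<le> norm (base_mean n k)"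
    using base_means_bounded_below[OF assms] by blast
  have bound: "(height_dist (Suc m))\<^sup>2 \<le> 3 / c\<^sup>2 * (\<Sum>i<3. (jump (m + i))\<^sup>2)" if "N \<le> m" for m
  proof -
    have "(height_dist (Suc m) * c)\<^sup>2 \<le> (\<Sum>i<3. jump (m + i))\<^sup>2"
      using height_dist_mult_le_jumps[of c m] \<open>0 < c\<close> below that by (intro power_mono) auto
    also have "\<dots> \<le> (\<Sum>i<3. (jump (m + i))\<^sup>2) * 3"
      using sum_squared_le_sum_of_squares[of "\<lambda>i. jump (m + i)" "{..<3}"] by simp
    finally show ?thesis using \<open>0 < c\<close> by (simp add: field_simps)
  qed
  have "summable (\<lambda>m. 3 / c\<^sup>2 * (\<Sum>i<3. (jump (m + i))\<^sup>2))"
    using summable_jump_square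
    by (intro summable_mult summable_sum) (simp add: summable_iff_shift[of "\<lambda>n. (jump n)\<^sup>2"])
  hence "summable (\<lambda>m. (height_dist (Suc m))\<^sup>2)"
    by (rule summable_comparison_test'[where N = N]) (simp only: real_norm_def abs_power2 bound)
  thus ?thesis by (simp add: summable_Suc_iff[of "\<lambda>n. (height_dist n)\<^sup>2"])
qed

end

lemma L2_eigenvalue_imp_summable:
  assumes "L2_eigenvalue \<mu> T (unit_char \<alpha>)" shows "summable (\<lambda>n. (height_dist n)\<^sup>2)"
  using assms summable_height_dist_square unfolding L2_eigenvalue_def by metis

section \<open>Measurable eigenvalues: sufficiency\<close>

text \<open>A Doeblin condition: the means over the towers of level \<open>m + 1\<close> are averages of those of
  level \<open>m\<close> whose weights are at least \<open>1 / L\<close>.\<close>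

lemma tower_mean_diff_contraction:
  assumes g: "level_constant m g"
    and osc: "\<And>k k'. k \<in> towers m \<Longrightarrow> k' \<in> towers m \<Longrightarrow> \<bar>tower_mean g m k - tower_mean g m k'\<bar> \<le> D"
    and l: "l \<in> towers (Suc m)" "l' \<in> towers (Suc m)"
  shows "\<bar>tower_mean g (Suc m) l - tower_mean g (Suc m) l'\<bar> \<le> (1 - 1 / L) * D"
proof -
  define w where "w l k = real (card (visits m l k)) * real (h m k) / real (h (Suc m) l)" for l k
  have nonneg: "0 \<le> w l k" for l k by (simp add: w_def)
  have mean: "tower_mean g (Suc m) l = (\<Sum>k\<in>towers m. w l k * tower_mean g m k)"
    and total: "(\<Sum>k\<in>towers m. w l k) = 1" and lower: "1 / L \<le> w l 1"
    if l: "l \<in> towers (Suc m)" for l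
  proof -
    have pos: "0 < real (h (Suc m) l)" using height_pos[OF l] by simp
    have "tower_mean g (Suc m) l
        = (\<Sum>k\<in>towers m. real (card (visits m l k)) * (real (h m k) * tower_mean g m k))
          / real (h (Suc m) l)"
      using height_mult_tower_mean_Suc[OF g l] pos by (simp add: field_simps)
    thus "tower_mean g (Suc m) l = (\<Sum>k\<in>towers m. w l k * tower_mean g m k)"
      by (simp add: w_def sum_divide_distrib mult.assoc)
    show "(\<Sum>k\<in>towers m. w l k) = 1"
      using pos by (simp add: w_def height_Suc[OF l] flip: sum_divide_distrib)
    show "1 / L \<le> w l 1"
      using height_Suc_div_le[OF l one_in_towers] pos by (simp add: w_def field_simps)
  qed
  show ?thesis
    unfolding mean[OF l(1)] mean[OF l(2)]
    by (rule abs_diff_convex_sums_le[OF finite_towers one_in_towers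
          nonneg total[OF l(1)] lower[OF l(1)] nonneg total[OF l(2)] lower[OF l(2)] osc])
qed

lemma tower_mean_diff_le:
  assumes g: "level_constant m g" and bound: "\<And>x. x \<in> X \<Longrightarrow> \<bar>g x\<bar> \<le> c"
    and "k \<in> towers (m + d)" "k' \<in> towers (m + d)"
  shows "\<bar>tower_mean g (m + d) k - tower_mean g (m + d) k'\<bar> \<le> (1 - 1 / L) ^ d * (2 * c)"
  using assms(3,4)
proof (induction d arbitrary: k k')
  case 0
  have "\<bar>tower_mean g m k\<bar> \<le> c" if k: "k \<in> towers m" for k
  proof -
    have "\<bar>\<Sum>j<h m k. g (sample_point m k j)\<bar> \<le> (\<Sum>j<h m k. \<bar>g (sample_point m k j)\<bar>)"
      by (rule sum_abs)
    also have "\<dots> \<le> (\<Sum>j<h m k. c)" by (intro sum_mono bound sample_point_in k)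
    also have "\<dots> = c * real (h m k)" by simp
    finally show ?thesis using height_pos[OF k] by (simp add: tower_mean_def pos_divide_le_eq)
  qed
  from this[of k] this[of k'] 0 show ?case by simp
next
  case (Suc d)
  have "level_constant (m + d) g" by (rule level_constant_mono[OF g]) simp
  hence "\<bar>tower_mean g (Suc (m + d)) k - tower_mean g (Suc (m + d)) k'\<bar>
      \<le> (1 - 1 / L) * ((1 - 1 / L) ^ d * (2 * c))"
    using Suc.prems by (intro tower_mean_diff_contraction Suc.IH) simp_all
  thus ?case by (simp add: mult.assoc)
qed

lemma tower_mean_near_expectation:
  assumes g: "level_constant m g" "g \<in> borel_measurable \<mu>" and bound: "\<And>x. x \<in> X \<Longrightarrow> \<bar>g x\<bar> \<le> c"
    and k: "k \<in> towers (m + d)"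
  shows "\<bar>tower_mean g (m + d) k - expectation g\<bar> \<le> (1 - 1 / L) ^ d * (2 * c)"
proof -
  let ?t = "tower_mean g (m + d)" and ?w = "\<lambda>k. real (h (m + d) k) * base_measure (m + d) k"
  have "level_constant (m + d) g" by (rule level_constant_mono[OF g(1)]) simp
  hence "expectation g = (\<Sum>k\<in>towers (m + d). ?w k * ?t k)"
    using integrable_if_bounded[OF g(2) bound] by (rule integral_level_constant)
  hence "?t k - expectation g
      = (\<Sum>k'\<in>towers (m + d). ?w k') * ?t k - (\<Sum>k'\<in>towers (m + d). ?w k' * ?t k')"
    by (simp only: sum_height_base_measure mult_1)
  hence "\<bar>?t k - expectation g\<bar> = \<bar>\<Sum>k'\<in>towers (m + d). ?w k' * (?t k - ?t k')\<bar>"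
    by (simp only: right_diff_distrib sum_subtractf sum_distrib_right)
  also have "\<dots> \<le> (\<Sum>k'\<in>towers (m + d). \<bar>?w k' * (?t k - ?t k')\<bar>)"
    by (rule sum_abs)
  also have "\<dots> = (\<Sum>k'\<in>towers (m + d). ?w k' * \<bar>?t k - ?t k'\<bar>)"
    by (simp add: abs_mult)
  also have "\<dots> \<le> (\<Sum>k'\<in>towers (m + d). ?w k' * ((1 - 1 / L) ^ d * (2 * c)))"
    by (intro sum_mono mult_left_mono tower_mean_diff_le[OF g(1) bound k]) auto
  also have "\<dots> = (1 - 1 / L) ^ d * (2 * c)"
    by (simp only: sum_distrib_right[symmetric] sum_height_base_measure mult_1)
  finally show ?thesis .
qed

subsection \<open>Centred residues of the entry increments\<close>

definition residue :: "nat \<Rightarrow> 'a \<Rightarrow> real" where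
  "residue n x = signed_dnint (\<alpha> * real (entry_increment n x))"

definition centred_residue :: "nat \<Rightarrow> 'a \<Rightarrow> real" where
  "centred_residue n x = residue n x - expectation (residue n)"

lemma residue_measurable [measurable]: "residue n \<in> borel_measurable \<mu>"
  unfolding residue_def entry_increment_def by measurable

lemma abs_residue_le: "x \<in> X \<Longrightarrow> \<bar>residue n x\<bar> \<le> L * height_dist n"
  using dnint_entry_increment_le by (simp add: residue_def abs_signed_dnint)

lemma residue_integrable: "integrable \<mu> (residue n)"
  by (rule integrable_if_bounded[OF residue_measurable abs_residue_le])

lemma centred_residue_measurable [measurable]: "centred_residue n \<in> borel_measurable \<mu>"
  unfolding centred_residue_def by measurable

lemma expectation_centred_residue: "expectation (centred_residue n) = 0"
  unfolding centred_residue_def using residue_integrable by simp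

lemma abs_centred_residue_le:
  assumes "x \<in> X" shows "\<bar>centred_residue n x\<bar> \<le> 2 * L * height_dist n"
proof -
  have "\<bar>expectation (residue n)\<bar> \<le> L * height_dist n"
    using abs_set_integral_le[OF residue_measurable abs_residue_le sets.top, of n]
      set_integral_space[OF residue_integrable, of n] by simp
  with abs_residue_le[OF assms, of n] show ?thesis unfolding centred_residue_def by linarith
qed

lemma centred_residue_integrable: "integrable \<mu> (centred_residue n)"
  by (rule integrable_if_bounded[OF centred_residue_measurable abs_centred_residue_le])

lemma abs_centred_residue_mult_le:
  assumes "x \<in> X"
  shows "\<bar>centred_residue n x * centred_residue m x\<bar> \<le> 4 * L\<^sup>2 * (height_dist n * height_dist m)"
proof -
  have "\<bar>centred_residue n x * centred_residue m x\<bar>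
      \<le> (2 * L * height_dist n) * (2 * L * height_dist m)"
    unfolding abs_mult using two_le_L by (intro mult_mono abs_centred_residue_le assms) auto
  thus ?thesis by (simp add: power2_eq_square mult_ac)
qed

lemma centred_residue_mult_integrable:
  "integrable \<mu> (\<lambda>x. centred_residue n x * centred_residue m x)"
  by (rule integrable_if_bounded[OF _ abs_centred_residue_mult_le]) measurable

lemma level_constant_centred_residue: "level_constant (Suc n) (centred_residue n)"
  unfolding level_constant_def
proof (intro ballI)
  fix x y assume "x \<in> X" "y \<in> cell (Suc n) x"
  hence "entry_time (Suc n) y = entry_time (Suc n) x" "entry_time n y = entry_time n x"
    by (simp_all add: entry_time_cell)
  thus "centred_residue n y = centred_residue n x"
    by (simp add: centred_residue_def residue_def entry_increment_def)
qed

lemma centred_residue_funpow: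
  assumes x: "x \<in> X" and j: "j \<le> entry_time n x"
  shows "centred_residue n ((T ^^ j) x) = centred_residue n x"
proof -
  have "j \<le> entry_time (Suc n) x" using j entry_time_mono[OF x, of n "Suc n"] by simp
  hence "entry_increment n ((T ^^ j) x) = entry_increment n x"
    using j by (simp add: entry_increment_def entry_time_funpow x)
  thus ?thesis by (simp add: centred_residue_def residue_def)
qed

lemma set_integral_atom_centred_residue:
  assumes k: "k \<in> towers n" and j: "j < h n k"
  shows "(LINT x:atom n k j|\<mu>. centred_residue n x) = (LINT x:B n k|\<mu>. centred_residue n x)"
proof -
  have "centred_residue n ((T ^^ j) x) = centred_residue n x" if "x \<in> atom n k j" for x
  proof (rule centred_residue_funpow)
    show "x \<in> X" using that preim_subset by blast
    show "j \<le> entry_time n x" using entry_time_eq[OF k j that] by simp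
  qed
  hence "(LINT x:atom n k j|\<mu>. centred_residue n x)
      = (LINT x:atom n k j|\<mu>. centred_residue n ((T ^^ j) x))"
    using k by (intro set_lebesgue_integral_cong) auto
  also have "\<dots> = (LINT x:B n k|\<mu>. centred_residue n x)"
    by (rule set_integral_funpow[OF centred_residue_measurable base_sets[OF k]])
  finally show ?thesis .
qed

lemma abs_correlation_Suc_add_le:
  "\<bar>expectation (\<lambda>x. centred_residue n x * centred_residue (Suc n + d) x)\<bar>
    \<le> 8 * L\<^sup>2 * (1 - 1 / L) ^ d * (height_dist n * height_dist (Suc n + d))"
proof -
  let ?m = "Suc n + d"
  let ?t = "tower_mean (centred_residue n) ?m" and ?I = "\<lambda>k. LINT x:B ?m k|\<mu>. centred_residue ?m x"
  let ?K = "8 * L\<^sup>2 * (1 - 1 / L) ^ d * (height_dist n * height_dist ?m)"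
  have mean_le: "\<bar>?t k\<bar> \<le> (1 - 1 / L) ^ d * (4 * L * height_dist n)" if "k \<in> towers ?m" for k
    using tower_mean_near_expectation[OF level_constant_centred_residue centred_residue_measurable
        abs_centred_residue_le that] by (simp add: expectation_centred_residue)
  have integral_le: "\<bar>?I k\<bar> \<le> 2 * L * height_dist ?m * base_measure ?m k" if "k \<in> towers ?m" for k
    using that by (intro abs_set_integral_le abs_centred_residue_le) auto
  have "level_constant ?m (centred_residue n)"
    by (rule level_constant_mono[OF level_constant_centred_residue]) simp
  hence "expectation (\<lambda>x. centred_residue n x * centred_residue ?m x)
      = (\<Sum>k\<in>towers ?m. real (h ?m k) * ?t k * ?I k)"
    by (intro integral_level_constant_mult centred_residue_mult_integrable
        set_integral_atom_centred_residue)
  hence "\<bar>expectation (\<lambda>x. centred_residue n x * centred_residue ?m x)\<bar>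
      \<le> (\<Sum>k\<in>towers ?m. \<bar>real (h ?m k) * ?t k * ?I k\<bar>)"
    by (simp only: sum_abs)
  also have "\<dots> = (\<Sum>k\<in>towers ?m. real (h ?m k) * (\<bar>?t k\<bar> * \<bar>?I k\<bar>))"
    by (simp add: abs_mult mult.assoc)
  also have "\<dots> \<le> (\<Sum>k\<in>towers ?m. real (h ?m k) *
      ((1 - 1 / L) ^ d * (4 * L * height_dist n) * (2 * L * height_dist ?m * base_measure ?m k)))"
    using two_le_L
    by (intro sum_mono mult_left_mono mult_mono mean_le integral_le mult_nonneg_nonneg
        zero_le_power) auto
  also have "\<dots> = ?K * (\<Sum>k\<in>towers ?m. real (h ?m k) * base_measure ?m k)"
    unfolding sum_distrib_left by (intro sum.cong refl) (simp add: power2_eq_square mult_ac)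
  finally show ?thesis by (simp only: sum_height_base_measure mult_1_right)
qed

lemma correlation_less_le:
  assumes "n < m"
  shows "expectation (\<lambda>x. centred_residue n x * centred_residue m x)
    \<le> 16 * L\<^sup>2 * ((1 - 1 / L) ^ nat \<bar>int n - int m\<bar> * (height_dist n * height_dist m))"
proof -
  let ?\<theta> = "1 - 1 / L"
  obtain d where m: "m = Suc n + d" using less_imp_Suc_add[OF assms] by auto
  have "1 / 2 \<le> ?\<theta>" using two_le_L by (simp add: field_simps)
  hence "1 * ?\<theta> ^ d \<le> 2 * ?\<theta> * ?\<theta> ^ d" by (intro mult_right_mono) auto
  hence "?\<theta> ^ d \<le> 2 * ?\<theta> ^ Suc d" by (simp only: power_Suc mult.assoc mult_1)
  moreover have "nat \<bar>int n - int m\<bar> = Suc d" using m by simp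
  ultimately have power_le: "?\<theta> ^ d \<le> 2 * ?\<theta> ^ nat \<bar>int n - int m\<bar>" by (simp only:)
  have "expectation (\<lambda>x. centred_residue n x * centred_residue m x)
      \<le> 8 * L\<^sup>2 * ?\<theta> ^ d * (height_dist n * height_dist m)"
    using order_trans[OF abs_ge_self abs_correlation_Suc_add_le[of n d]] by (simp only: m)
  also have "\<dots> \<le> 8 * L\<^sup>2 * (2 * ?\<theta> ^ nat \<bar>int n - int m\<bar>) * (height_dist n * height_dist m)"
    by (intro mult_right_mono mult_left_mono power_le) auto
  finally show ?thesis by (simp add: mult.assoc)
qed

lemma correlation_le:
  "expectation (\<lambda>x. centred_residue n x * centred_residue m x)
    \<le> 16 * L\<^sup>2 * ((1 - 1 / L) ^ nat \<bar>int n - int m\<bar> * (height_dist n * height_dist m))"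
proof (cases n m rule: linorder_cases)
  case less
  thus ?thesis by (rule correlation_less_le)
next
  case greater
  from correlation_less_le[OF this] show ?thesis by (simp add: mult.commute abs_minus_commute)
next
  case equal
  have "expectation (\<lambda>x. centred_residue n x * centred_residue m x)
      \<le> expectation (\<lambda>_. 4 * L\<^sup>2 * (height_dist n * height_dist m))"
    using abs_centred_residue_mult_le
    by (intro integral_mono centred_residue_mult_integrable) (auto simp: abs_le_iff)
  also have "\<dots> \<le> 16 * L\<^sup>2 * (height_dist n * height_dist m)" by (simp add: mult_right_mono)
  finally show ?thesis using equal by simp
qed

lemma expectation_sum_centred_residue_square_le:
  assumes "finite A"
  shows "expectation (\<lambda>x. (\<Sum>n\<in>A. centred_residue n x)\<^sup>2) \<le> (\<Sum>n\<in>A. 32 * L ^ 3 * (height_dist n)\<^sup>2)"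
proof -
  let ?t = "\<lambda>n m. (1 - 1 / L) ^ nat \<bar>int n - int m\<bar>"
  have \<theta>: "0 \<le> 1 - 1 / L" "1 - 1 / L < 1" using two_le_L by simp_all
  have "expectation (\<lambda>x. (\<Sum>n\<in>A. centred_residue n x)\<^sup>2)
      = (\<Sum>n\<in>A. \<Sum>m\<in>A. expectation (\<lambda>x. centred_residue n x * centred_residue m x))"
    by (simp add: power2_eq_square sum_product centred_residue_mult_integrable)
  also have "\<dots> \<le> (\<Sum>n\<in>A. \<Sum>m\<in>A. 16 * L\<^sup>2 * (?t n m * (height_dist n * height_dist m)))"
    by (intro sum_mono correlation_le)
  also have "\<dots> = 16 * L\<^sup>2 * (\<Sum>n\<in>A. \<Sum>m\<in>A. ?t n m * (height_dist n * height_dist m))"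
    by (simp only: sum_distrib_left)
  also have "\<dots> \<le> 16 * L\<^sup>2 * (2 / (1 - (1 - 1 / L)) * (\<Sum>n\<in>A. (height_dist n)\<^sup>2))"
    using \<theta> by (intro mult_left_mono Schur_quadratic_form_le sum_power_dist_le assms)
      (auto simp: abs_minus_commute)
  also have "\<dots> = (\<Sum>n\<in>A. 32 * L ^ 3 * (height_dist n)\<^sup>2)"
    by (simp add: power2_eq_square power3_eq_cube sum_distrib_left mult_ac)
  finally show ?thesis .
qed

lemma phase_eq_centred_residues:
  assumes x: "x \<in> X"
  shows "unit_char (\<Sum>n<N. expectation (residue n)) * phase N x
    = phase 0 x * unit_char (- (\<Sum>n<N. centred_residue n x))"
proof (induction N)
  case (Suc N)
  have "unit_char (- (\<alpha> * real (entry_increment N x))) = unit_char (- residue N x)"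
    by (simp add: residue_def unit_char_minus)
  hence "unit_char (\<Sum>n<Suc N. expectation (residue n)) * phase (Suc N) x
      = (unit_char (\<Sum>n<N. expectation (residue n)) * phase N x)
        * (unit_char (expectation (residue N)) * unit_char (- residue N x))"
    using phase_Suc[OF x, of N] by (simp add: unit_char_add mult_ac)
  also have "unit_char (expectation (residue N)) * unit_char (- residue N x)
      = unit_char (- centred_residue N x)"
    by (simp add: centred_residue_def flip: unit_char_add)
  finally show ?case unfolding Suc by (simp add: mult.assoc flip: unit_char_add)
qed simp

lemma summable_imp_L2_eigenvalue:
  assumes "summable (\<lambda>n. (height_dist n)\<^sup>2)" shows "L2_eigenvalue \<mu> T (unit_char \<alpha>)"
proof -
  obtain r where r: "strict_mono r" "AE x in \<mu>. convergent (\<lambda>i. \<Sum>n<r i. centred_residue n x)"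
    using L2_series_AE_convergent_subseq[OF centred_residue_integrable
        centred_residue_mult_integrable expectation_sum_centred_residue_square_le
        summable_mult[OF assms]] by blast
  let ?\<kappa> = "\<lambda>i. unit_char (\<Sum>n<r i. expectation (residue n))"
  define f where "f x = lim (\<lambda>i. ?\<kappa> i * phase (r i) x)" for x
  have measurable: "f \<in> borel_measurable \<mu>" unfolding f_def by measurable
  have limit: "AE x in \<mu>. (\<lambda>i. ?\<kappa> i * phase (r i) x) \<longlonglongrightarrow> f x"
    using r(2) AE_space
  proof eventually_elim
    case (elim x)
    obtain y where "(\<lambda>i. \<Sum>n<r i. centred_residue n x) \<longlonglongrightarrow> y"
      using elim(1) by (auto simp: convergent_def)
    hence "(\<lambda>i. phase 0 x * unit_char (- (\<Sum>n<r i. centred_residue n x)))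
        \<longlonglongrightarrow> phase 0 x * unit_char (- y)"
      unfolding unit_char_def by (intro tendsto_intros)
    hence "(\<lambda>i. ?\<kappa> i * phase (r i) x) \<longlonglongrightarrow> phase 0 x * unit_char (- y)"
      using elim(2) by (simp add: phase_eq_centred_residues)
    thus ?case unfolding f_def by (simp add: limI)
  qed
  have unimodular: "AE x in \<mu>. norm (f x) = 1"
    using limit
  proof eventually_elim
    case (elim x)
    from tendsto_norm[OF this] show ?case by (simp add: norm_mult LIMSEQ_const_iff)
  qed
  show ?thesis
    unfolding L2_eigenvalue_def
    using measurable unimodular_square_integrable[OF measurable unimodular]
      unimodular_not_AE_zero[OF measurable unimodular] AE_eigen_limit_phase[OF r(1) limit] by blast
qed

end

lemma linearly_recurrent_seqE:
  assumes "linearly_recurrent_seq C h"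
  obtains L where "2 \<le> L"
    "\<And>n l k. l \<in> {1..C (Suc n)} \<Longrightarrow> k \<in> {1..C n} \<Longrightarrow> real (h (Suc n) l) \<le> L * real (h n k)"
proof -
  obtain K where K: "real (h (Suc n) l) \<le> K * real (h n k)"
    if "l \<in> {1..C (Suc n)}" "k \<in> {1..C n}" for n l k
    using assms unfolding linearly_recurrent_seq_def by (metis diff_Suc_1 le_add1 plus_1_eq_Suc)
  have "real (h (Suc n) l) \<le> max 2 K * real (h n k)"
    if "l \<in> {1..C (Suc n)}" "k \<in> {1..C n}" for n l k
    using K[OF that] by (rule order_trans) (intro mult_right_mono; simp)
  thus ?thesis by (intro that[of "max 2 K"]) auto
qed

theorem theorem1:
  fixes X :: "'a::metric_space set" and T Ti :: "'a \<Rightarrow> 'a"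
    and C :: "nat \<Rightarrow> nat" and B :: "nat \<Rightarrow> nat \<Rightarrow> 'a set" and h :: "nat \<Rightarrow> nat \<Rightarrow> nat"
    and \<mu> :: "'a measure" and \<alpha> :: real
  assumes "minimal_cantor_system X T Ti"
    and "KR_sequence X T C B h"
    and "linearly_recurrent_seq C h"
    and "invariant_prob X T \<mu>"
  shows "(L2_eigenvalue \<mu> T (exp (2 * \<i> * pi * complex_of_real \<alpha>)) \<longleftrightarrow>
           summable (\<lambda>n. (vnorm (C (n + 2)) (\<lambda>l. \<alpha> * PH1 X T C B h (n + 2) l))\<^sup>2))
       \<and> (continuous_eigenvalue X \<mu> T (exp (2 * \<i> * pi * complex_of_real \<alpha>)) \<longleftrightarrow>
           summable (\<lambda>n. vnorm (C (n + 2)) (\<lambda>l. \<alpha> * PH1 X T C B h (n + 2) l)))"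
proof -
  interpret kakutani_rohlin X T Ti C B h
    using assms(1,2) by unfold_locales (auto simp: minimal_cantor_system_def)
  obtain L where L: "2 \<le> L"
      "\<And>n l k. l \<in> towers (Suc n) \<Longrightarrow> k \<in> towers n \<Longrightarrow> real (h (Suc n) l) \<le> L * real (h n k)"
    using linearly_recurrent_seqE[OF assms(3)] unfolding towers_def by blast
  interpret linearly_recurrent_measure X T Ti C B h L \<alpha> \<mu>
    using assms(1,4) L by unfold_locales
  have character: "exp (2 * \<i> * pi * complex_of_real \<alpha>) = unit_char \<alpha>"
    by (simp add: unit_char_def cis_conv_exp mult_ac)
  have "L2_eigenvalue \<mu> T (unit_char \<alpha>) \<longleftrightarrow> summable (\<lambda>n. (height_dist (n + 2))\<^sup>2)"
    unfolding summable_iff_shift[of "\<lambda>n. (height_dist n)\<^sup>2" 2]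
    using L2_eigenvalue_imp_summable summable_imp_L2_eigenvalue by blast
  moreover have "continuous_eigenvalue X \<mu> T (unit_char \<alpha>) \<longleftrightarrow> summable (\<lambda>n. height_dist (n + 2))"
    unfolding summable_iff_shift[of height_dist 2]
    using continuous_eigenvalue_imp_summable summable_imp_continuous_eigenvalue by blast
  ultimately show ?thesis unfolding character vnorm_PH1_eq_height_dist by blast
qed

end
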